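(* Let $n,m\ge1$, $d=n+m$. Let $N^{irr}(n,m)\subset\mathbb{R}^{mn}$ be the set of real $m\times n$ matrices $\Theta$ (identified with points of $\mathbb{R}^{mn}$) such that $\Theta$ is a badly approximable matrix and the $n$-dimensional subspace $\{(x,y)\in\mathbb{R}^n\times\mathbb{R}^m: y=\Theta x\}\subset\mathbb{R}^d$ is completely irrational. Then $N^{irr}(n,m)$ is $\alpha$-winning for every $0<\alpha\le\frac12$.
   Context: A real $m\times n$ matrix $\Theta=(\theta_j^i)$ is badly approximable if, writing $L_j(x)=\theta_j^1x_1+\dots+\theta_j^nx_n$ ($j=1,\dots,m$), there is $c>0$ such that $(\max_i|x_i|)^n(\max_j\|L_j(x)\|)^m>c$ for all $x\in\mathbb{Z}^n\setminus\{0\}$, where $\|\cdot\|$ is the distance to the nearest integer. A linear subspace of $\mathbb{R}^d$ is rational if it has a basis of integer vectors. An $n$-dimensional subspace $\mathcal{L}\subset\mathbb{R}^d$, $n<d$, is completely irrational if $\mathcal{L}\cap\mathcal{M}=\{0\}$ for every rational subspace $\mathcal{M}$ of dimension $d-n$. Schmidt's $(\alpha,\beta)$-game in $\mathbb{R}^r$: Bob and Alice alternately choose closed balls $B_1\supset A_1\supset B_2\supset\cdots$ with $\rho(A_i)=\alpha\rho(B_i)$, $\rho(B_{i+1})=\beta\rho(A_i)$; $E$ is $(\alpha,\beta)$-winning if Alice can guarantee $\bigcap_i A_i\subset E$ regardless of Bob's play, and $\alpha$-winning if it is $(\alpha,\beta)$-winning for all $0<\beta<1$. *)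

theory Defs
  imports "HOL-Analysis.Analysis"
begin

definition dist_nearest_int :: "real \<Rightarrow> real" where
  "dist_nearest_int t = \<bar>t - of_int (round t)\<bar>"

text \<open>The entry \<open>\<Theta> $ j $ i\<close> is \<open>\<theta>\<^sub>j\<^sup>i\<close>, so \<open>'n\<close> indexes columns and \<open>'m\<close> indexes rows.\<close>

definition lin_form :: "real^'n^'m \<Rightarrow> 'm \<Rightarrow> int^'n \<Rightarrow> real" where
  "lin_form \<Theta> j x = (\<Sum>i\<in>UNIV. \<Theta> $ j $ i * of_int (x $ i))"

definition badly_approximable :: "real^'n^'m \<Rightarrow> bool" where
  "badly_approximable \<Theta> \<longleftrightarrow>
    (\<exists>c>0. \<forall>x::int^'n. x \<noteq> 0 \<longrightarrow>
      (MAX i\<in>UNIV. \<bar>real_of_int (x $ i)\<bar>) ^ CARD('n) *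
      (MAX j\<in>UNIV. dist_nearest_int (lin_form \<Theta> j x)) ^ CARD('m) > c)"

text \<open>The next definition is used for \<open>(real^'n) \<times> (real^'m)\<close>, whose \<open>Basis\<close> is the standard
  basis of \<open>\<real>\<^sup>n\<^sup>+\<^sup>m\<close>.\<close>

definition integer_vector :: "'a::euclidean_space \<Rightarrow> bool" where
  "integer_vector v \<longleftrightarrow> (\<forall>b\<in>Basis. v \<bullet> b \<in> \<int>)"

definition rational_subspace :: "'a::euclidean_space set \<Rightarrow> bool" where
  "rational_subspace M \<longleftrightarrow>
    (\<exists>B. independent B \<and> span B = M \<and> (\<forall>v\<in>B. integer_vector v))"

definition completely_irrational :: "'a::euclidean_space set \<Rightarrow> bool" where
  "completely_irrational L \<longleftrightarrow> subspace L \<and> dim L < DIM('a) \<and>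
    (\<forall>M. rational_subspace M \<and> dim M = DIM('a) - dim L \<longrightarrow> L \<inter> M = {0})"

text \<open>A closed ball is represented by its centre and its radius.\<close>

type_synonym 'a gball = "'a \<times> real"

definition ball_set :: "'a::metric_space gball \<Rightarrow> 'a set" where
  "ball_set D = cball (fst D) (snd D)"

definition alice_legal :: "real \<Rightarrow> 'a::metric_space gball \<Rightarrow> 'a gball \<Rightarrow> bool" where
  "alice_legal \<alpha> B A \<longleftrightarrow> snd A = \<alpha> * snd B \<and> ball_set A \<subseteq> ball_set B"

fun bob_legal ::
    "real \<Rightarrow> (nat \<Rightarrow> 'a::metric_space gball) \<Rightarrow> (nat \<Rightarrow> 'a gball) \<Rightarrow> nat \<Rightarrow> bool" where
  "bob_legal \<beta> B A 0 \<longleftrightarrow> snd (B 0) > 0"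
| "bob_legal \<beta> B A (Suc i) \<longleftrightarrow>
     snd (B (Suc i)) = \<beta> * snd (A i) \<and> ball_set (B (Suc i)) \<subseteq> ball_set (A i)"

text \<open>A strategy \<open>\<sigma>\<close> of Alice answers the list of the moves Bob has made so far.\<close>

definition alice_moves :: "('a gball list \<Rightarrow> 'a gball) \<Rightarrow> (nat \<Rightarrow> 'a gball) \<Rightarrow> nat \<Rightarrow> 'a gball" where
  "alice_moves \<sigma> B i = \<sigma> (map B [0..<Suc i])"

text \<open>The first conjunct below obliges Alice to move legally after every finite legal play of Bob,
  so that she cannot win by leaving Bob without a legal move.\<close>

definition winning :: "real \<Rightarrow> real \<Rightarrow> 'a::euclidean_space set \<Rightarrow> bool" where
  "winning \<alpha> \<beta> E \<longleftrightarrow> (\<exists>\<sigma>. \<forall>B.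
     (\<forall>k. (\<forall>i\<le>k. bob_legal \<beta> B (alice_moves \<sigma> B) i) \<longrightarrow>
        alice_legal \<alpha> (B k) (alice_moves \<sigma> B k)) \<and>
     ((\<forall>i. bob_legal \<beta> B (alice_moves \<sigma> B) i) \<longrightarrow>
        (\<Inter>i. ball_set (alice_moves \<sigma> B i)) \<subseteq> E))"

definition alpha_winning :: "real \<Rightarrow> 'a::euclidean_space set \<Rightarrow> bool" where
  "alpha_winning \<alpha> E \<longleftrightarrow> (\<forall>\<beta>. 0 < \<beta> \<and> \<beta> < 1 \<longrightarrow> winning \<alpha> \<beta> E)"

text \<open>The norm of \<open>real^'n^'m\<close> is the Euclidean norm of the \<open>mn\<close> entries, so \<open>cball\<close> on this type is
  the closed Euclidean ball of \<open>\<real>\<^sup>m\<^sup>n\<close>.\<close>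

definition N_irr :: "(real^'n^'m) set" where
  "N_irr = {\<Theta>. badly_approximable \<Theta> \<and>
     completely_irrational {(x :: real^'n, y :: real^'m). y = \<Theta> *v x}}"

end

theory Submission
  imports Defs
begin

text \<open>
  Call \<open>\<Theta>\<close> well spaced at scale \<open>\<theta>\<close> if the renormalised lattice of the points \<open>(x, y - \<Theta> x)\<close>, with \<open>x\<close>, \<open>y\<close>
  integral, has no very short nonzero vector. Being badly approximable means being well spaced at a
  geometric sequence of scales. Alice keeps both \<open>\<Theta>\<close> and its transpose well spaced at the scale of the
  current ball, in stages of bounded length. Since the transpose is well spaced, the integer vectors that
  might become too short during the next stage span a space \<open>M\<close> of dimension at most \<open>m\<close> (Blichfeldt's
  lemma); symmetrically for the transpose. Transversality of \<open>M\<close> to the graph of \<open>\<Theta>\<close> is the nonvanishing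
  of a nonzero polynomial in \<open>\<Theta>\<close>, which Alice can force by descending along its derivatives, and by
  compactness of the set of all \<open>M\<close> she can do so quantitatively, in a bounded number of rounds. The vectors of \<open>M\<close>
  then grow instead of shrinking. In the \<open>k\<close>-th stage she makes the graph transversal to the \<open>k\<close>-th rational
  subspace as well, which yields complete irrationality.
\<close>

subsection \<open>Forcing in boundedly many rounds\<close>

text \<open>The graph of \<Theta> has dimension n, so it can be transversal to M only if dim M \<le>
  m, and being well spaced does not in general bound the span of the short vectors that way. This is
  why the transpose is carried along: its lattice is dual to that of \<Theta>, and m + 1 independent
  short vectors would produce a dual vector that is too short. The order of the constants matters.
  The forcing time \<open>N\<close> and the transversality constant \<open>\<kappa>\<close> depend
  only on \<alpha>, \<beta>, n and m. They determine the contraction p \<le> \<kappa> of a stage,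
  and only then is \<delta> taken small in terms of p and of Bob's first ball. Later stages keep the
  same \<delta>, because the expansion by 1 / p^n makes up for the loss of a factor \<kappa> \<ge>
  p.\<close>

text \<open>The state \<open>(c, r)\<close> is a ball of Bob. Since the rules fix the radii, only
  centres are quantified, and inclusion of balls is expressed by the distance of their
  centres.\<close>

fun forces :: "real \<Rightarrow> real \<Rightarrow> nat \<Rightarrow> ('a::metric_space \<Rightarrow> real \<Rightarrow> bool) \<Rightarrow> 'a \<Rightarrow> real \<Rightarrow> bool" where
  "forces \<alpha> \<beta> 0 Q c r \<longleftrightarrow> Q c r"
| "forces \<alpha> \<beta> (Suc N) Q c r \<longleftrightarrow>
     (\<exists>a. dist a c \<le> (1 - \<alpha>) * r \<and>
       (\<forall>c'. dist c' a \<le> (1 - \<beta>) * \<alpha> * r \<longrightarrow> forces \<alpha> \<beta> N Q c' (\<alpha> * \<beta> * r)))"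

lemma forces_mono:
  assumes "forces \<alpha> \<beta> N Q c r" and "\<And>c r. Q c r \<Longrightarrow> Q' c r"
  shows "forces \<alpha> \<beta> N Q' c r"
  using assms(1)
proof (induction N arbitrary: c r)
  case (Suc N)
  from Suc.prems obtain a where "dist a c \<le> (1 - \<alpha>) * r"
    "\<And>c'. dist c' a \<le> (1 - \<beta>) * \<alpha> * r \<Longrightarrow> forces \<alpha> \<beta> N Q c' (\<alpha> * \<beta> * r)"
    by auto
  then show ?case using Suc.IH by (auto intro!: exI[of _ a])
qed (use assms(2) in auto)

lemma forces_compose:
  assumes "forces \<alpha> \<beta> N Q c r" and "\<And>c r. Q c r \<Longrightarrow> forces \<alpha> \<beta> N' Q' c r"
  shows "forces \<alpha> \<beta> (N + N') Q' c r"
  using assms(1)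
proof (induction N arbitrary: c r)
  case (Suc N)
  from Suc.prems obtain a where "dist a c \<le> (1 - \<alpha>) * r"
    "\<And>c'. dist c' a \<le> (1 - \<beta>) * \<alpha> * r \<Longrightarrow> forces \<alpha> \<beta> N Q c' (\<alpha> * \<beta> * r)"
    by auto
  then show ?case using Suc.IH by (auto intro!: exI[of _ a])
qed (use assms(2) in auto)

text \<open>The game is invariant under similarities: Alice plays the image of her move, and
  surjectivity of \<open>S\<close> pulls Bob's reply back. This serves both for rescaling to the
  unit ball and for transposing matrices.\<close>

lemma forces_similarity:
  fixes S :: "'a::metric_space \<Rightarrow> 'b::metric_space"
  assumes S: "\<And>x y. dist (S x) (S y) = k * dist x y" "surj S" "k > 0"
    and "forces \<alpha> \<beta> N (\<lambda>c r. Q (S c) (k * r)) c r"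
  shows "forces \<alpha> \<beta> N Q (S c) (k * r)"
  using assms(4)
proof (induction N arbitrary: c r)
  case (Suc N)
  then obtain a where a: "dist a c \<le> (1 - \<alpha>) * r"
    "\<And>c'. dist c' a \<le> (1 - \<beta>) * \<alpha> * r \<Longrightarrow> forces \<alpha> \<beta> N (\<lambda>c r. Q (S c) (k * r)) c' (\<alpha> * \<beta> * r)"
    by auto
  have "dist (S a) (S c) \<le> (1 - \<alpha>) * (k * r)"
    using a(1) S(1,3) by (simp add: mult.left_commute)
  moreover have "forces \<alpha> \<beta> N Q c' (\<alpha> * \<beta> * (k * r))"
    if c': "dist c' (S a) \<le> (1 - \<beta>) * \<alpha> * (k * r)" for c'
  proof -
    obtain b where b: "c' = S b" using S(2) by blast
    have "k * dist b a \<le> k * ((1 - \<beta>) * \<alpha> * r)"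
      using c' S(1) by (simp add: b ac_simps)
    then have "dist b a \<le> (1 - \<beta>) * \<alpha> * r" using S(3) by simp
    from Suc.IH[OF a(2)[OF this]] show ?thesis by (simp add: b ac_simps)
  qed
  ultimately show ?case by auto
qed simp

lemma forces_affine:
  fixes c :: "'a::real_normed_vector"
  assumes "\<rho> > 0" and "forces \<alpha> \<beta> N (\<lambda>c' r. Q (c + \<rho> *\<^sub>R c') (\<rho> * r)) 0 1"
  shows "forces \<alpha> \<beta> N Q c \<rho>"
proof -
  have "surj (\<lambda>x. c + \<rho> *\<^sub>R x)"
    using assms(1) by (intro surjI[of _ "\<lambda>y. (y - c) /\<^sub>R \<rho>"]) simp
  moreover have "dist (c + \<rho> *\<^sub>R x) (c + \<rho> *\<^sub>R y) = \<rho> * dist x y" for x y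
    using assms(1) by (simp add: dist_norm flip: scaleR_right_diff_distrib)
  ultimately have "forces \<alpha> \<beta> N Q (c + \<rho> *\<^sub>R 0) (\<rho> * 1)"
    using assms by (intro forces_similarity[where S = "\<lambda>x. c + \<rho> *\<^sub>R x"]) auto
  then show ?thesis by simp
qed

section \<open>Drift in a prescribed direction\<close>

locale schmidt_game =
  fixes \<alpha> \<beta> :: real
  assumes alpha: "0 < \<alpha>" "\<alpha> \<le> 1 / 2" and beta: "0 < \<beta>" "\<beta> < 1"
begin

abbreviation q :: real where "q \<equiv> \<alpha> * \<beta>"

text \<open>The drift per round that Alice can guarantee in a given direction, in units of the
  radius: she moves by 1 - \<alpha>, and Bob can undo at most (1 - \<beta>) \<alpha>. Its positivity
  is where \<alpha> \<le> 1/2 enters.\<close>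

definition \<gamma> :: real where "\<gamma> = 1 - 2 * \<alpha> + \<alpha> * \<beta>"

lemma q_pos: "0 < q" and q_less_1: "q < 1" and \<gamma>_pos: "0 < \<gamma>"
proof -
  show "0 < q" using alpha beta by simp
  have "\<alpha> * \<beta> < \<alpha> * 1" using alpha beta by (intro mult_strict_left_mono) auto
  then show "q < 1" using alpha by linarith
  show "0 < \<gamma>" using alpha \<open>0 < q\<close> by (simp add: \<gamma>_def)
qed

text \<open>Alice always plays as far as possible along \<open>u\<close>. The drift of the first
  round is kept, since no later round has a negative one; with no round at all there is none, hence
  the case \<open>N = 0\<close>.\<close>

lemma forces_push_aux:
  fixes c u :: "'a::euclidean_space"
  assumes "r > 0" "norm u = 1"
  shows "forces \<alpha> \<beta> N (\<lambda>c' r'. r' = q ^ N * r \<and> cball c' r' \<subseteq> cball c r \<and>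
           (c' - c) \<bullet> u \<ge> (if N = 0 then 0 else \<gamma> * r)) c r"
  using assms(1)
proof (induction N arbitrary: c r)
  case (Suc N)
  let ?a = "c + ((1 - \<alpha>) * r) *\<^sub>R u"
  have "dist ?a c \<le> (1 - \<alpha>) * r"
    using alpha Suc.prems assms(2) by (simp add: dist_norm)
  moreover have "forces \<alpha> \<beta> N (\<lambda>c'' r''. r'' = q ^ Suc N * r \<and> cball c'' r'' \<subseteq> cball c r \<and>
           (c'' - c) \<bullet> u \<ge> \<gamma> * r) c' (q * r)"
    if c': "dist c' ?a \<le> (1 - \<beta>) * \<alpha> * r" for c'
  proof -
    have "\<bar>(c' - ?a) \<bullet> u\<bar> \<le> norm (c' - ?a) * norm u" by (rule Cauchy_Schwarz_ineq2)
    also have "\<dots> \<le> (1 - \<beta>) * \<alpha> * r" using c' assms(2) by (simp add: dist_norm)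
    finally have "(c' - ?a) \<bullet> u \<ge> - ((1 - \<beta>) * \<alpha> * r)" by linarith
    moreover have "(c' - ?a) \<bullet> u = (c' - c) \<bullet> u - (1 - \<alpha>) * r"
      using assms(2) by (simp add: algebra_simps dot_square_norm)
    ultimately have 1: "(c' - c) \<bullet> u \<ge> \<gamma> * r" by (simp add: \<gamma>_def algebra_simps)
    have "dist c' c \<le> dist c' ?a + dist ?a c" by (rule dist_triangle)
    also have "\<dots> \<le> (1 - \<beta>) * \<alpha> * r + (1 - \<alpha>) * r"
      using c' \<open>dist ?a c \<le> _\<close> by linarith
    finally have "dist c' c + q * r \<le> r" by (simp add: algebra_simps)
    then have 2: "cball c' (q * r) \<subseteq> cball c r" by (simp add: cball_subset_cball_iff)
    have "q * r > 0" using q_pos Suc.prems by simp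
    from Suc.IH[OF this, of c'] show ?thesis
    proof (rule forces_mono)
      fix c'' r''
      assume A: "r'' = q ^ N * (q * r) \<and> cball c'' r'' \<subseteq> cball c' (q * r) \<and>
        (if N = 0 then 0 else \<gamma> * (q * r)) \<le> (c'' - c') \<bullet> u"
      have "0 \<le> (if N = 0 then 0 else \<gamma> * (q * r))"
        using \<gamma>_pos \<open>q * r > 0\<close> by auto
      then have "(c'' - c') \<bullet> u \<ge> 0" using A by linarith
      then have "(c'' - c) \<bullet> u \<ge> (c' - c) \<bullet> u" by (simp add: algebra_simps)
      then show "r'' = q ^ Suc N * r \<and> cball c'' r'' \<subseteq> cball c r \<and> \<gamma> * r \<le> (c'' - c) \<bullet> u"
        using A 1 2 by (auto simp: ac_simps)
    qed
  qed
  ultimately show ?case by auto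
qed auto

lemma forces_wait:
  fixes c :: "'a::euclidean_space"
  assumes "r > 0"
  shows "forces \<alpha> \<beta> N (\<lambda>c' r'. r' = q ^ N * r \<and> cball c' r' \<subseteq> cball c r) c r"
proof -
  obtain u :: 'a where "norm u = 1" using norm_Basis SOME_Basis by blast
  from forces_push_aux[OF assms this, of N c] show ?thesis by (rule forces_mono) simp
qed

lemma forces_nested:
  fixes c :: "'a::euclidean_space"
  assumes "r > 0" "forces \<alpha> \<beta> N Q c r"
  shows "forces \<alpha> \<beta> N (\<lambda>c' r'. Q c' r' \<and> r' = q ^ N * r \<and> cball c' r' \<subseteq> cball c r) c r"
  using assms
proof (induction N arbitrary: c r)
  case (Suc N)
  then obtain a where a: "dist a c \<le> (1 - \<alpha>) * r"
    "\<And>c'. dist c' a \<le> (1 - \<beta>) * \<alpha> * r \<Longrightarrow> forces \<alpha> \<beta> N Q c' (q * r)"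
    by auto
  have "forces \<alpha> \<beta> N (\<lambda>c'' r''. Q c'' r'' \<and> r'' = q ^ Suc N * r \<and> cball c'' r'' \<subseteq> cball c r)
          c' (q * r)" if c': "dist c' a \<le> (1 - \<beta>) * \<alpha> * r" for c'
  proof -
    have "dist c' c \<le> dist c' a + dist a c" by (rule dist_triangle)
    then have "dist c' c + q * r \<le> r" using c' a(1) by (simp add: algebra_simps)
    then have 2: "cball c' (q * r) \<subseteq> cball c r" by (simp add: cball_subset_cball_iff)
    have "q * r > 0" using q_pos Suc.prems(1) by simp
    from Suc.IH[OF this a(2)[OF c']] show ?thesis
      by (rule forces_mono) (use 2 in \<open>auto simp: ac_simps\<close>)
  qed
  then show ?case using a(1) by auto
qed auto

text \<open>Idle rounds do no harm when \<open>Q\<close> passes to smaller balls. This brings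
  different forcing times to a common length.\<close>

lemma forces_longer:
  fixes c :: "'a::euclidean_space"
  assumes "r > 0" "forces \<alpha> \<beta> N Q c r" "N \<le> N'"
    and "\<And>c r c' r'. Q c r \<Longrightarrow> cball c' r' \<subseteq> cball c r \<Longrightarrow> Q c' r'"
  shows "forces \<alpha> \<beta> N' Q c r"
proof -
  have "forces \<alpha> \<beta> (N + (N' - N)) Q c r"
    using forces_nested[OF assms(1,2)]
  proof (rule forces_compose)
    fix c' r'
    assume A: "Q c' r' \<and> r' = q ^ N * r \<and> cball c' r' \<subseteq> cball c r"
    then have "r' > 0" using assms(1) q_pos by simp
    from forces_wait[OF this, of "N' - N" c'] show "forces \<alpha> \<beta> (N' - N) Q c' r'"
      by (rule forces_mono) (use A assms(4) in blast)
  qed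
  then show ?thesis using assms(3) by simp
qed

text \<open>The number of rounds after which the radius is at most half the drift, so that the whole
  ball and not only its centre has moved along \<open>u\<close>. Being positive, it includes the
  round that produces the drift.\<close>

definition push_time :: nat where "push_time = (SOME t. q ^ t \<le> \<gamma> / 2 \<and> t > 0)"

lemma push_time: "q ^ push_time \<le> \<gamma> / 2" "push_time > 0"
proof -
  obtain t where "q ^ t < \<gamma> / 2" using real_arch_pow_inv[of "\<gamma> / 2" q] \<gamma>_pos q_less_1 by auto
  moreover have "q ^ Suc t \<le> q ^ t" using q_pos q_less_1 by (intro power_decreasing) auto
  ultimately have "q ^ Suc t \<le> \<gamma> / 2 \<and> Suc t > 0" by auto
  then have "q ^ push_time \<le> \<gamma> / 2 \<and> push_time > 0" unfolding push_time_def by (rule someI)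
  then show "q ^ push_time \<le> \<gamma> / 2" "push_time > 0" by auto
qed

lemma forces_push:
  fixes c u :: "'a::euclidean_space"
  assumes "r > 0" "norm u = 1"
  shows "forces \<alpha> \<beta> push_time (\<lambda>c' r'. \<forall>x\<in>cball c' r'. x \<in> cball c r \<and> (x - c) \<bullet> u \<ge> \<gamma> * r / 2) c r"
  using forces_push_aux[OF assms, of push_time c]
proof (rule forces_mono, intro ballI)
  fix c' r' x
  assume A: "r' = q ^ push_time * r \<and> cball c' r' \<subseteq> cball c r \<and>
    (if push_time = 0 then 0 else \<gamma> * r) \<le> (c' - c) \<bullet> u" and x: "x \<in> cball c' r'"
  have "\<bar>(x - c') \<bullet> u\<bar> \<le> norm (x - c') * norm u" by (rule Cauchy_Schwarz_ineq2)
  also have "\<dots> \<le> q ^ push_time * r" using A x assms(2) by (simp add: dist_norm norm_minus_commute)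
  also have "\<dots> \<le> \<gamma> / 2 * r" using push_time assms(1) by (intro mult_right_mono) auto
  finally have "(x - c') \<bullet> u \<ge> - (\<gamma> / 2 * r)" by linarith
  moreover have "(x - c) \<bullet> u = (x - c') \<bullet> u + (c' - c) \<bullet> u" by (simp add: algebra_simps)
  ultimately have "(x - c) \<bullet> u \<ge> \<gamma> * r / 2" using A push_time(2) by auto
  then show "x \<in> cball c r \<and> (x - c) \<bullet> u \<ge> \<gamma> * r / 2" using A x by auto
qed

section \<open>From forced stages to a winning strategy\<close>

text \<open>The state predicate \<open>W\<close> may depend on Bob's first ball \<open>(c\<^sub>0, r\<^sub>0)\<close>; Alice's strategy only looks at
  this ball, at the last one and at the number of rounds played.\<close>

lemma winning_if_invariant:
  fixes E :: "'a::euclidean_space set"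
  assumes init: "\<And>c r. r > 0 \<Longrightarrow> W (c, r) 0 c r"
    and step: "\<And>D i c r. snd D > 0 \<Longrightarrow> r > 0 \<Longrightarrow> W D i c r \<Longrightarrow> forces \<alpha> \<beta> 1 (W D (Suc i)) c r"
    and final: "\<And>B x. snd (B 0) > 0 \<Longrightarrow> (\<And>i. W (B 0) i (fst (B i)) (snd (B i))) \<Longrightarrow>
      (\<And>i. x \<in> ball_set (B i)) \<Longrightarrow> x \<in> E"
  shows "winning \<alpha> \<beta> E"
proof -
  define good where "good D i D1 A \<longleftrightarrow> alice_legal \<alpha> D1 A \<and>
    (\<forall>D'. snd D' = \<beta> * snd A \<and> ball_set D' \<subseteq> ball_set A \<longrightarrow> W D (Suc i) (fst D') (snd D'))"
    for D D1 A :: "'a gball" and i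
  define \<sigma> where "\<sigma> l = (SOME A. good (hd l) (length l - 1) (last l) A)" for l :: "'a gball list"
  have ex: "\<exists>A. good D i (c, r) A" if D: "snd D > 0" "r > 0" "W D i c r" for D i c r
  proof -
    obtain a where a: "dist a c \<le> (1 - \<alpha>) * r"
      "\<And>c'. dist c' a \<le> (1 - \<beta>) * \<alpha> * r \<Longrightarrow> W D (Suc i) c' (q * r)"
      using step[OF D] by auto
    have "good D i (c, r) (a, \<alpha> * r)"
      unfolding good_def alice_legal_def ball_set_def
    proof (intro conjI allI impI)
      show "cball (fst (a, \<alpha> * r)) (snd (a, \<alpha> * r)) \<subseteq> cball (fst (c, r)) (snd (c, r))"
        using a(1) by (simp add: cball_subset_cball_iff algebra_simps)
    next
      fix D' :: "'a gball"
      assume A: "snd D' = \<beta> * snd (a, \<alpha> * r) \<and>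
        cball (fst D') (snd D') \<subseteq> cball (fst (a, \<alpha> * r)) (snd (a, \<alpha> * r))"
      then have "snd D' = q * r" "snd D' > 0" using q_pos D(2) beta alpha by auto
      then have "dist (fst D') a \<le> (1 - \<beta>) * \<alpha> * r"
        using A by (auto simp: cball_subset_cball_iff algebra_simps)
      then show "W D (Suc i) (fst D') (snd D')" using a(2) \<open>snd D' = q * r\<close> by simp
    qed simp
    then show ?thesis by blast
  qed
  have hd: "hd (map B [0..<Suc i]) = B 0" for B :: "nat \<Rightarrow> 'a gball" and i
    by (simp add: hd_map upt_rec)
  have play: "snd (B k) > 0 \<and> snd (B 0) > 0 \<and> W (B 0) k (fst (B k)) (snd (B k)) \<and>
      good (B 0) k (B k) (alice_moves \<sigma> B k)"
    if "\<forall>i\<le>k. bob_legal \<beta> B (alice_moves \<sigma> B) i" for B k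
    using that
  proof (induction k)
    case 0
    then have B0: "snd (B 0) > 0" by simp
    then have W: "W (B 0) 0 (fst (B 0)) (snd (B 0))" using init[of "snd (B 0)" "fst (B 0)"] by simp
    have "\<exists>A. good (B 0) 0 (B 0) A" using ex[OF B0 B0 W] by simp
    then have "good (B 0) 0 (B 0) (alice_moves \<sigma> B 0)"
      by (simp add: alice_moves_def \<sigma>_def someI_ex)
    then show ?case using B0 W by simp
  next
    case (Suc k)
    then have IH: "snd (B k) > 0" "snd (B 0) > 0" "good (B 0) k (B k) (alice_moves \<sigma> B k)" by auto
    from Suc.prems have "bob_legal \<beta> B (alice_moves \<sigma> B) (Suc k)" by blast
    then have leg: "snd (B (Suc k)) = \<beta> * snd (alice_moves \<sigma> B k)"
      "ball_set (B (Suc k)) \<subseteq> ball_set (alice_moves \<sigma> B k)" by auto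
    have W: "W (B 0) (Suc k) (fst (B (Suc k))) (snd (B (Suc k)))"
      using IH(3) leg unfolding good_def by blast
    have pos: "snd (B (Suc k)) > 0"
      using IH(1,3) leg(1) alpha beta by (simp add: good_def alice_legal_def)
    have "\<exists>A. good (B 0) (Suc k) (B (Suc k)) A" using ex[OF IH(2) pos W] by simp
    moreover have "alice_moves \<sigma> B (Suc k) = (SOME A. good (B 0) (Suc k) (B (Suc k)) A)"
      unfolding alice_moves_def \<sigma>_def hd by simp
    ultimately have "good (B 0) (Suc k) (B (Suc k)) (alice_moves \<sigma> B (Suc k))"
      by (simp add: someI_ex)
    then show ?case using W pos IH(2) by simp
  qed
  show ?thesis
    unfolding winning_def
  proof (intro exI[of _ \<sigma>] allI conjI impI)
    fix B k assume "\<forall>i\<le>k. bob_legal \<beta> B (alice_moves \<sigma> B) i"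
    from play[OF this] show "alice_legal \<alpha> (B k) (alice_moves \<sigma> B k)" by (simp add: good_def)
  next
    fix B assume leg: "\<forall>i. bob_legal \<beta> B (alice_moves \<sigma> B) i"
    show "(\<Inter>i. ball_set (alice_moves \<sigma> B i)) \<subseteq> E"
    proof
      fix x assume x: "x \<in> (\<Inter>i. ball_set (alice_moves \<sigma> B i))"
      have p: "snd (B 0) > 0 \<and> W (B 0) k (fst (B k)) (snd (B k)) \<and>
        alice_legal \<alpha> (B k) (alice_moves \<sigma> B k)" for k
        using play[of k B] leg by (simp add: good_def)
      have "x \<in> ball_set (B i)" for i using x p[of i] by (auto simp: alice_legal_def)
      then show "x \<in> E" using final[of B x] p by blast
    qed
  qed
qed

lemma winning_if_stages:
  fixes E :: "'a::euclidean_space set"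
  assumes T: "T > 0"
    and init: "\<And>c r. r > 0 \<Longrightarrow> Inv (c, r) 0 c r"
    and step: "\<And>D k c r. snd D > 0 \<Longrightarrow> r > 0 \<Longrightarrow> Inv D k c r \<Longrightarrow> forces \<alpha> \<beta> T (Inv D (Suc k)) c r"
    and final: "\<And>B x. snd (B 0) > 0 \<Longrightarrow> (\<And>k. Inv (B 0) k (fst (B (k * T))) (snd (B (k * T)))) \<Longrightarrow>
      (\<And>i. x \<in> ball_set (B i)) \<Longrightarrow> x \<in> E"
  shows "winning \<alpha> \<beta> E"
proof -
  \<comment> \<open>During a stage the invariant is the promise that \<open>Inv\<close> for the next
    stage can be forced in the remaining rounds. At a multiple of \<open>T\<close> the promise has
    just been fulfilled, and \<open>step\<close> supplies the next one.\<close>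
  define W where "W D i c r \<longleftrightarrow> (i mod T = 0 \<longrightarrow> Inv D (i div T) c r) \<and>
    forces \<alpha> \<beta> (T - i mod T) (Inv D (Suc (i div T))) c r" for D i c r
  show ?thesis
  proof (rule winning_if_invariant[of W])
    fix c :: 'a and r :: real assume "r > 0"
    then show "W (c, r) 0 c r" using init step by (simp add: W_def)
  next
    fix D :: "'a gball" and i c r
    assume D: "snd D > 0" and r: "r > 0" and W: "W D i c r"
    have lt: "i mod T < T" using T by simp
    define j where "j = T - i mod T - 1"
    have j: "T - i mod T = Suc j" using lt by (simp add: j_def)
    have "forces \<alpha> \<beta> 1 (forces \<alpha> \<beta> j (Inv D (Suc (i div T)))) c r"
      using W unfolding W_def j by simp
    from forces_nested[OF r this] show "forces \<alpha> \<beta> 1 (W D (Suc i)) c r"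
    proof (rule forces_mono)
      fix c' r'
      assume A: "forces \<alpha> \<beta> j (Inv D (Suc (i div T))) c' r' \<and> r' = q ^ 1 * r \<and> cball c' r' \<subseteq> cball c r"
      then have r': "r' > 0" using q_pos r by simp
      show "W D (Suc i) c' r'"
      proof (cases "j = 0")
        case True
        then have "Suc (i mod T) = T" using j lt by linarith
        then have "Suc i mod T = 0" "Suc i div T = Suc (i div T)" by (auto simp: mod_Suc div_Suc)
        moreover have "Inv D (Suc (i div T)) c' r'" using True conjunct1[OF A] by simp
        ultimately show ?thesis using step[OF D r'] by (simp add: W_def)
      next
        case False
        then have "Suc (i mod T) < T" using j by linarith
        then have "Suc i mod T = Suc (i mod T)" "Suc i div T = i div T" by (auto simp: mod_Suc div_Suc)
        moreover have "T - Suc (i mod T) = j" using j by simp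
        ultimately show ?thesis using conjunct1[OF A] by (simp add: W_def)
      qed
    qed
  next
    fix B x
    assume B: "snd (B 0) > 0" "\<And>i. W (B 0) i (fst (B i)) (snd (B i))" "\<And>i. x \<in> ball_set (B i)"
    have "Inv (B 0) k (fst (B (k * T))) (snd (B (k * T)))" for k
      using B(2)[of "k * T"] T by (simp add: W_def)
    then show "x \<in> E" using final B(1,3) by blast
  qed
qed

end

subsection \<open>Avoiding zeros of polynomials\<close>

text \<open>Polynomials of degree at most \<open>D\<close>, described through their derivatives because the winning
  strategy below descends along derivatives.\<close>

primrec poly_deg :: "nat \<Rightarrow> ('a::euclidean_space \<Rightarrow> real) \<Rightarrow> bool" where
  "poly_deg 0 f \<longleftrightarrow> (\<exists>k. f = (\<lambda>_. k))"
| "poly_deg (Suc D) f \<longleftrightarrow> (\<exists>F. continuous_on UNIV F \<and>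
     (\<forall>x. (f has_derivative (\<lambda>h. F x \<bullet> h)) (at x)) \<and> (\<forall>u. poly_deg D (\<lambda>x. F x \<bullet> u)))"

lemma poly_deg_const: "poly_deg D (\<lambda>_. k)"
proof (induction D arbitrary: k)
  case (Suc D)
  then show ?case by (auto intro!: exI[of _ "\<lambda>_. 0"])
qed auto

lemma poly_deg_Suc: "poly_deg D f \<Longrightarrow> poly_deg (Suc D) f"
proof (induction D arbitrary: f)
  case 0
  then obtain k where "f = (\<lambda>_. k)" by auto
  then show ?case using poly_deg_const by blast
next
  case (Suc D)
  then obtain F where "continuous_on UNIV F" "\<forall>x. (f has_derivative (\<lambda>h. F x \<bullet> h)) (at x)"
    "\<forall>u. poly_deg D (\<lambda>x. F x \<bullet> u)" by auto
  then show ?case using Suc.IH poly_deg.simps(2) by blast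
qed

lemma poly_deg_mono: "poly_deg D f \<Longrightarrow> D \<le> D' \<Longrightarrow> poly_deg D' f"
  by (rule lift_Suc_mono_le[of "\<lambda>D. poly_deg D f", unfolded le_bool_def, rule_format])
    (auto intro: poly_deg_Suc simp del: poly_deg.simps)

lemma poly_deg_affine: "poly_deg (Suc 0) (\<lambda>x. a \<bullet> x + b)"
  by (auto intro!: exI[of _ "\<lambda>_. a"] derivative_eq_intros)

lemma poly_deg_add:
  "poly_deg D f \<Longrightarrow> poly_deg D g \<Longrightarrow> poly_deg D (\<lambda>x. f x + g x)"
proof (induction D arbitrary: f g)
  case (Suc D)
  obtain F where F: "continuous_on UNIV F" "\<And>x. (f has_derivative (\<lambda>h. F x \<bullet> h)) (at x)"
    "\<And>u. poly_deg D (\<lambda>x. F x \<bullet> u)" using Suc.prems(1) by auto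
  obtain G where G: "continuous_on UNIV G" "\<And>x. (g has_derivative (\<lambda>h. G x \<bullet> h)) (at x)"
    "\<And>u. poly_deg D (\<lambda>x. G x \<bullet> u)" using Suc.prems(2) by auto
  have "continuous_on UNIV (\<lambda>x. F x + G x)" using F(1) G(1) by (intro continuous_intros)
  moreover have "((\<lambda>x. f x + g x) has_derivative (\<lambda>h. (F x + G x) \<bullet> h)) (at x)" for x
    using has_derivative_add[OF F(2) G(2)] by (simp add: inner_add_left)
  moreover have "poly_deg D (\<lambda>x. (F x + G x) \<bullet> u)" for u
    using Suc.IH[OF F(3) G(3)] by (simp add: inner_add_left)
  ultimately show ?case by (simp, intro exI[of _ "\<lambda>x. F x + G x"]) simp
qed auto

lemma poly_deg_cmult: "poly_deg D f \<Longrightarrow> poly_deg D (\<lambda>x. k * f x)"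
proof (induction D arbitrary: f)
  case (Suc D)
  obtain F where F: "continuous_on UNIV F" "\<And>x. (f has_derivative (\<lambda>h. F x \<bullet> h)) (at x)"
    "\<And>u. poly_deg D (\<lambda>x. F x \<bullet> u)" using Suc.prems by auto
  have "continuous_on UNIV (\<lambda>x. k *\<^sub>R F x)" using F(1) by (intro continuous_intros)
  moreover have "((\<lambda>x. k * f x) has_derivative (\<lambda>h. (k *\<^sub>R F x) \<bullet> h)) (at x)" for x
    using has_derivative_mult_right[OF F(2), of k x] by simp
  moreover have "poly_deg D (\<lambda>x. (k *\<^sub>R F x) \<bullet> u)" for u
    using Suc.IH[OF F(3)] by simp
  ultimately show ?case by (simp, intro exI[of _ "\<lambda>x. k *\<^sub>R F x"]) simp
qed auto

text \<open>Induction on the sum of the degree bounds, because each summand of the product rule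
  lowers only one of them.\<close>

lemma poly_deg_mult:
  "poly_deg D f \<Longrightarrow> poly_deg D' g \<Longrightarrow> poly_deg (D + D') (\<lambda>x. f x * g x)"
proof (induction "D + D'" arbitrary: D D' f g)
  case 0
  then show ?case by auto
next
  case (Suc n)
  consider "D = 0" | "D' = 0" | E E' where "D = Suc E" "D' = Suc E'"
    by (metis not0_implies_Suc)
  then show ?case
  proof cases
    case 1
    then show ?thesis using Suc.prems by (auto intro: poly_deg_cmult)
  next
    case 2
    then obtain k where "g = (\<lambda>_. k)" using Suc.prems by auto
    then show ?thesis using 2 poly_deg_cmult[OF Suc.prems(1), of k] by (simp add: mult.commute)
  next
    case 3
    obtain F where F: "continuous_on UNIV F" "\<And>x. (f has_derivative (\<lambda>h. F x \<bullet> h)) (at x)"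
      "\<And>u. poly_deg E (\<lambda>x. F x \<bullet> u)" using Suc.prems(1) 3 by auto
    obtain G where G: "continuous_on UNIV G" "\<And>x. (g has_derivative (\<lambda>h. G x \<bullet> h)) (at x)"
      "\<And>u. poly_deg E' (\<lambda>x. G x \<bullet> u)" using Suc.prems(2) 3 by auto
    have c: "continuous_on UNIV f" "continuous_on UNIV g"
      using F(2) G(2) by (auto intro!: continuous_at_imp_continuous_on has_derivative_continuous)
    let ?H = "\<lambda>x. f x *\<^sub>R G x + g x *\<^sub>R F x"
    have "continuous_on UNIV ?H" using F(1) G(1) c by (intro continuous_intros)
    moreover have "((\<lambda>x. f x * g x) has_derivative (\<lambda>h. ?H x \<bullet> h)) (at x)" for x
      by (rule derivative_eq_intros F G refl)+ (simp add: inner_add_left mult.commute)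
    moreover have "poly_deg (E + D') (\<lambda>x. ?H x \<bullet> u)" for u
    proof -
      have "poly_deg (D + E') (\<lambda>x. f x * (G x \<bullet> u))"
        using Suc 3 G(3) by (intro Suc.hyps(1)) (auto simp del: poly_deg.simps)
      moreover have "poly_deg (E + D') (\<lambda>x. (F x \<bullet> u) * g x)"
        using Suc 3 F(3) by (intro Suc.hyps(1)) (auto simp del: poly_deg.simps)
      ultimately have "poly_deg (E + D') (\<lambda>x. f x * (G x \<bullet> u) + (F x \<bullet> u) * g x)"
        using 3 by (intro poly_deg_add) (simp_all del: poly_deg.simps)
      then show ?thesis by (simp add: inner_add_left ac_simps)
    qed
    ultimately have "poly_deg (Suc (E + D')) (\<lambda>x. f x * g x)" by auto
    then show ?thesis using 3 by (simp del: poly_deg.simps)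
  qed
qed

lemma poly_deg_sum:
  assumes "finite I" "\<And>i. i \<in> I \<Longrightarrow> \<exists>D. poly_deg D (f i)"
  shows "\<exists>D. poly_deg D (\<lambda>x. \<Sum>i\<in>I. f i x)"
  using assms
proof (induction I rule: finite_induct)
  case (insert i I)
  obtain D D' where "poly_deg D (f i)" "poly_deg D' (\<lambda>x. \<Sum>i\<in>I. f i x)" using insert by fastforce
  then have "poly_deg (max D D') (f i)" "poly_deg (max D D') (\<lambda>x. \<Sum>i\<in>I. f i x)"
    by (auto elim!: poly_deg_mono)
  then show ?case using poly_deg_add insert.hyps by fastforce
qed (use poly_deg_const in \<open>auto simp del: poly_deg.simps\<close>)

lemma poly_deg_prod:
  assumes "finite I" "\<And>i. i \<in> I \<Longrightarrow> \<exists>D. poly_deg D (f i)"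
  shows "\<exists>D. poly_deg D (\<lambda>x. \<Prod>i\<in>I. f i x)"
  using assms
proof (induction I rule: finite_induct)
  case (insert i I)
  obtain D D' where "poly_deg D (f i)" "poly_deg D' (\<lambda>x. \<Prod>i\<in>I. f i x)" using insert by fastforce
  then show ?case using poly_deg_mult insert.hyps by fastforce
qed (use poly_deg_const in \<open>auto simp del: poly_deg.simps\<close>)

lemma poly_deg_det:
  fixes A :: "'a::euclidean_space \<Rightarrow> real^'k^'k"
  assumes "\<And>i j. \<exists>D. poly_deg D (\<lambda>x. A x $ i $ j)"
  shows "\<exists>D. poly_deg D (\<lambda>x. det (A x))"
  unfolding det_def
proof (rule poly_deg_sum)
  fix p :: "'k \<Rightarrow> 'k"
  obtain D where "poly_deg D (\<lambda>x. \<Prod>i\<in>UNIV. A x $ i $ p i)"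
    using poly_deg_prod[of UNIV "\<lambda>i x. A x $ i $ p i"] assms by auto
  then show "\<exists>D. poly_deg D (\<lambda>x. of_int (sign p) * (\<Prod>i\<in>UNIV. A x $ i $ p i))"
    using poly_deg_cmult by blast
qed simp

section \<open>Forcing lower bounds for polynomials\<close>

context schmidt_game
begin

text \<open>The zeros are avoided quantitatively, on the whole final ball and after a number of
  rounds independent of the play. The unit ball is the normalised case, which
  \<open>forces_affine\<close> transfers to any other ball.\<close>

definition forceable :: "('a::euclidean_space \<Rightarrow> real) \<Rightarrow> bool" where
  "forceable f \<longleftrightarrow>
    (\<exists>N. \<exists>\<delta>>0. forces \<alpha> \<beta> N (\<lambda>c r. \<forall>x\<in>cball c r. \<bar>f x\<bar> \<ge> \<delta>) 0 1)"

text \<open>On a small ball where the gradient is bounded away from zero, \<open>f\<close> is nearly affine; pushing along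
  the gradient, upwards or downwards according to the sign of \<open>f\<close> at the centre, avoids its zeros.\<close>

lemma forceable_if_derivative_forceable:
  fixes f :: "'a::euclidean_space \<Rightarrow> real"
  assumes F: "continuous_on UNIV F" "\<And>x. (f has_derivative (\<lambda>h. F x \<bullet> h)) (at x)"
    and "forceable (\<lambda>x. F x \<bullet> u)"
  shows "forceable f"
proof -
  obtain N \<delta> where \<delta>: "\<delta> > 0" "forces \<alpha> \<beta> N (\<lambda>c r. \<forall>x\<in>cball c r. \<bar>F x \<bullet> u\<bar> \<ge> \<delta>) 0 1"
    using assms(3) by (auto simp: forceable_def)
  \<comment> \<open>A lower bound for the norm of the gradient itself, by Cauchy-Schwarz; adding 1
    keeps the denominator positive for \<open>u = 0\<close>.\<close>
  define \<delta>' where "\<delta>' = \<delta> / (norm u + 1)"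
  have u1: "norm u + 1 > 0" by (simp add: add_nonneg_pos)
  then have \<delta>': "\<delta>' > 0" using \<delta>(1) by (simp add: \<delta>'_def)
  have "uniformly_continuous_on (cball 0 1) F"
    using F(1) by (intro compact_uniformly_continuous) (auto intro: continuous_on_subset)
  \<comment> \<open>The oscillation \<open>\<delta>' * \<gamma> / 8\<close> makes the error of
    linearisation at most a quarter of the gain \<open>norm w * \<gamma> * r / 2\<close> from
    pushing.\<close>
  then obtain \<eta> where \<eta>: "\<eta> > 0"
    "\<And>x y. x \<in> cball 0 1 \<Longrightarrow> y \<in> cball 0 1 \<Longrightarrow> dist y x < \<eta> \<Longrightarrow> dist (F y) (F x) < \<delta>' * \<gamma> / 8"
    unfolding uniformly_continuous_on_def using \<delta>' \<gamma>_pos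
    by (metis divide_pos_pos mult_pos_pos zero_less_numeral)
  obtain J where J: "q ^ J < \<eta>" using real_arch_pow_inv[OF \<eta>(1) q_less_1] by blast
  define r where "r = q ^ (N + J)"
  have r: "r > 0" using q_pos by (simp add: r_def)
  have "q ^ (N + J) \<le> q ^ J" using q_pos q_less_1 by (intro power_decreasing) auto
  then have r\<eta>: "r < \<eta>" using J by (simp add: r_def)
  have "forces \<alpha> \<beta> (N + J) (\<lambda>c r. \<forall>x\<in>cball c r. \<bar>F x \<bullet> u\<bar> \<ge> \<delta>) 0 1"
    by (rule forces_longer[OF _ \<delta>(2)]) auto
  from forces_nested[OF zero_less_one this]
  have "forces \<alpha> \<beta> (N + J) (\<lambda>c s. s = r \<and> cball c s \<subseteq> cball 0 1 \<and>
      (\<forall>x\<in>cball c s. \<bar>F x \<bullet> u\<bar> \<ge> \<delta>)) 0 1"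
    by (rule forces_mono) (auto simp: r_def)
  then have "forces \<alpha> \<beta> (N + J + push_time) (\<lambda>c s. \<forall>x\<in>cball c s. \<bar>f x\<bar> \<ge> \<delta>' * \<gamma> * r / 4) 0 1"
  proof (rule forces_compose)
    fix c s
    assume A: "s = r \<and> cball c s \<subseteq> cball 0 1 \<and> (\<forall>x\<in>cball c s. \<bar>F x \<bullet> u\<bar> \<ge> \<delta>)"
    define w where "w = F c"
    have "c \<in> cball c s" using A r by simp
    then have "\<delta> \<le> \<bar>w \<bullet> u\<bar>" using A by (simp add: w_def)
    also have "\<dots> \<le> norm w * norm u" by (rule Cauchy_Schwarz_ineq2)
    also have "\<dots> \<le> norm w * (norm u + 1)" by (intro mult_left_mono) auto
    finally have w: "norm w \<ge> \<delta>'" using u1 by (simp add: \<delta>'_def divide_le_eq)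
    then have w0: "norm w > 0" using \<delta>' by linarith
    define e :: real where "e = (if f c \<ge> 0 then 1 else -1)"
    define v where "v = (e / norm w) *\<^sub>R w"
    have "norm v = 1" using w0 by (simp add: v_def e_def)
    from forces_push[OF r this, of c]
    show "forces \<alpha> \<beta> push_time (\<lambda>c s. \<forall>x\<in>cball c s. \<bar>f x\<bar> \<ge> \<delta>' * \<gamma> * r / 4) c s"
      unfolding conjunct1[OF A]
    proof (rule forces_mono, intro ballI)
      fix c' r' x
      assume "\<forall>x\<in>cball c' r'. x \<in> cball c r \<and> \<gamma> * r / 2 \<le> (x - c) \<bullet> v" "x \<in> cball c' r'"
      then have x: "x \<in> cball c r" "\<gamma> * r / 2 \<le> (x - c) \<bullet> v" by auto
      have "norm (f x - f c - w \<bullet> (x - c)) \<le> norm (x - c) * (\<delta>' * \<gamma> / 8)"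
      proof -
        have "norm ((\<lambda>x. f x - w \<bullet> x) x - (\<lambda>x. f x - w \<bullet> x) c) \<le> \<delta>' * \<gamma> / 8 * norm (x - c)"
        proof (rule differentiable_bound[where S = "cball c r" and f' = "\<lambda>x h. (F x - w) \<bullet> h"])
          fix y assume y: "y \<in> cball c r"
          have "((\<lambda>x. f x - w \<bullet> x) has_derivative (\<lambda>h. F y \<bullet> h - w \<bullet> h)) (at y within cball c r)"
            by (intro derivative_intros has_derivative_at_withinI[OF F(2)])
          then show "((\<lambda>x. f x - w \<bullet> x) has_derivative (\<lambda>h. (F y - w) \<bullet> h)) (at y within cball c r)"
            by (simp add: inner_diff_left)
          have "c \<in> cball c r" using r by simp
          then have "y \<in> cball 0 1" "c \<in> cball 0 1" using A y by blast+
          moreover have "dist y c < \<eta>" using y r\<eta> by (simp add: dist_commute)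
          ultimately have "norm (F y - w) \<le> \<delta>' * \<gamma> / 8"
            using \<eta>(2)[of c y] by (simp add: w_def dist_norm)
          moreover have "norm ((F y - w) \<bullet> h) \<le> norm (F y - w) * norm h" for h
            by (simp add: Cauchy_Schwarz_ineq2)
          ultimately show "onorm (\<lambda>h. (F y - w) \<bullet> h) \<le> \<delta>' * \<gamma> / 8"
            by (intro onorm_le) (meson mult_right_mono norm_ge_zero order_trans)
        qed (use x r in auto)
        then show ?thesis by (simp add: algebra_simps)
      qed
      also have "\<dots> \<le> r * (norm w * \<gamma> / 8)"
        using x w \<gamma>_pos r \<delta>' by (intro mult_mono) (auto simp: dist_norm norm_minus_commute)
      finally have 1: "\<bar>f x - f c - w \<bullet> (x - c)\<bar> \<le> r * (norm w * \<gamma> / 8)" by simp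
      have ew: "e * (w \<bullet> (x - c)) = norm w * ((x - c) \<bullet> v)"
        using w0 by (simp add: v_def inner_commute)
      have "norm w * ((x - c) \<bullet> v) \<ge> norm w * (\<gamma> * r / 2)" using x(2) by (intro mult_left_mono) auto
      then have 2: "e * (w \<bullet> (x - c)) \<ge> norm w * (\<gamma> * r / 2)" by (simp add: ew)
      have 3: "norm w * (\<gamma> * r) \<ge> \<delta>' * (\<gamma> * r)" using w \<gamma>_pos r by (intro mult_right_mono) auto
      define P where "P = norm w * (\<gamma> * r)"
      define t where "t = w \<bullet> (x - c)"
      have P: "\<bar>f x - f c - t\<bar> \<le> P / 8" "e * t \<ge> P / 2" "\<delta>' * \<gamma> * r \<le> P" "P > 0"
        using 1 2 3 w0 \<gamma>_pos r by (simp_all add: P_def t_def ac_simps)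
      have "\<bar>f x\<bar> \<ge> P / 4"
      proof (cases "f c \<ge> 0")
        case True
        then have "t \<ge> P / 2" using P(2) by (simp add: e_def)
        then show ?thesis using P(1,4) True by linarith
      next
        case False
        then have "- t \<ge> P / 2" using P(2) by (simp add: e_def)
        then show ?thesis using P(1,4) False by linarith
      qed
      then show "\<bar>f x\<bar> \<ge> \<delta>' * \<gamma> * r / 4" using P(3) by linarith
    qed
  qed
  then show ?thesis unfolding forceable_def using \<delta>' \<gamma>_pos r
    by (intro exI[of _ "N + J + push_time"] exI[of _ "\<delta>' * \<gamma> * r / 4"]) auto
qed

text \<open>If the gradient vanishes identically, \<open>f\<close> is a nonzero constant. Otherwise
  the derivative in the direction \<open>F y\<close> is nonzero at \<open>y\<close> and has a
  smaller degree bound. The point of nonvanishing may lie outside the unit ball.\<close>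

lemma forceable_polynomial:
  fixes f :: "'a::euclidean_space \<Rightarrow> real"
  assumes "poly_deg D f" "f x \<noteq> 0"
  shows "forceable f"
  using assms
proof (induction D arbitrary: f x)
  case 0
  then obtain k where "f = (\<lambda>_. k)" "k \<noteq> 0" by auto
  then show ?case unfolding forceable_def by (intro exI[of _ 0] exI[of _ "\<bar>k\<bar>"]) auto
next
  case (Suc D)
  then obtain F where F: "continuous_on UNIV F" "\<And>x. (f has_derivative (\<lambda>h. F x \<bullet> h)) (at x)"
    "\<And>u. poly_deg D (\<lambda>x. F x \<bullet> u)" by auto
  show ?case
  proof (cases "\<forall>y. F y = 0")
    case True
    then have "\<And>y. y \<in> UNIV \<Longrightarrow> (f has_derivative (\<lambda>h. 0)) (at y within UNIV)" using F(2) by simp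
    then obtain k where k: "\<And>y. y \<in> UNIV \<Longrightarrow> f y = k"
      using has_derivative_zero_constant[of UNIV f] by auto
    then have "k \<noteq> 0" using Suc.prems(2) by auto
    then show ?thesis unfolding forceable_def using k by (intro exI[of _ 0] exI[of _ "\<bar>k\<bar>"]) auto
  next
    case False
    then obtain y where "F y \<bullet> F y \<noteq> 0" by auto
    then have "forceable (\<lambda>x. F x \<bullet> F y)" using Suc.IH[OF F(3)] by blast
    then show ?thesis using forceable_if_derivative_forceable[OF F(1,2)] by blast
  qed
qed

text \<open>A strategy for a limit parameter works with half its bound for all nearby parameters,
  since play stays in the unit ball, where \<open>f p\<close> depends uniformly on
  \<open>p\<close>.\<close>

lemma forceable_uniform:
  fixes f :: "'p::metric_space \<Rightarrow> 'a::euclidean_space \<Rightarrow> real"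
  assumes K: "compact K" and cont: "continuous_on (K \<times> UNIV) (\<lambda>(p, x). f p x)"
    and f: "\<And>p. p \<in> K \<Longrightarrow> forceable (f p)"
  shows "\<exists>N. \<exists>\<delta>>0. \<forall>p\<in>K. forces \<alpha> \<beta> N (\<lambda>c r. \<forall>x\<in>cball c r. \<bar>f p x\<bar> \<ge> \<delta>) 0 1"
proof (rule ccontr)
  assume neg: "\<not> ?thesis"
  \<comment> \<open>Tying the time and the lower bound to one index turns the failure of every pair
    into a single sequence of bad parameters.\<close>
  define bad where "bad k p \<longleftrightarrow>
    \<not> forces \<alpha> \<beta> k (\<lambda>c r. \<forall>x\<in>cball c r. \<bar>f p x\<bar> \<ge> 1 / real (Suc k)) 0 1" for k p
  have "\<exists>p\<in>K. bad k p" for k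
  proof (rule ccontr)
    assume "\<not> ?thesis"
    then have "\<forall>p\<in>K. forces \<alpha> \<beta> k (\<lambda>c r. \<forall>x\<in>cball c r. \<bar>f p x\<bar> \<ge> 1 / real (Suc k)) 0 1"
      by (auto simp: bad_def)
    moreover have "1 / real (Suc k) > 0" by simp
    ultimately show False using neg by blast
  qed
  then obtain p where p: "\<And>k. p k \<in> K" "\<And>k. bad k (p k)" by metis
  obtain l s where l: "l \<in> K" "strict_mono s" "(p \<circ> s) \<longlonglongrightarrow> l"
    using K p(1) by (metis compact_def)
  obtain N \<delta> where \<delta>: "\<delta> > 0" "forces \<alpha> \<beta> N (\<lambda>c r. \<forall>x\<in>cball c r. \<bar>f l x\<bar> \<ge> \<delta>) 0 1"
    using f[OF l(1)] by (auto simp: forceable_def)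
  have "compact (K \<times> cball (0::'a) 1)" using K by (intro compact_Times) auto
  then have "uniformly_continuous_on (K \<times> cball 0 1) (\<lambda>(p, x). f p x)"
    by (intro compact_uniformly_continuous continuous_on_subset[OF cont]) auto
  then obtain \<eta> where \<eta>: "\<eta> > 0" "\<And>y z. y \<in> K \<times> cball 0 1 \<Longrightarrow> z \<in> K \<times> cball 0 1 \<Longrightarrow>
      dist z y < \<eta> \<Longrightarrow> dist ((\<lambda>(p, x). f p x) z) ((\<lambda>(p, x). f p x) y) < \<delta> / 2"
    unfolding uniformly_continuous_on_def using \<delta>(1) by (metis half_gt_zero)
  have close: "\<bar>f p' x - f l x\<bar> < \<delta> / 2" if "p' \<in> K" "dist p' l < \<eta>" "x \<in> cball 0 1" for p' x
    using \<eta>(2)[of "(l, x)" "(p', x)"] that l(1) by (simp add: dist_Pair_Pair dist_real_def)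
  have "\<forall>\<^sub>F k in sequentially. dist ((p \<circ> s) k) l < \<eta>"
    using l(3) \<eta>(1) by (rule tendstoD)
  moreover have "\<forall>\<^sub>F k in sequentially. k \<ge> N" by (rule eventually_ge_at_top)
  moreover have "\<forall>\<^sub>F k in sequentially. 1 / real (Suc k) < \<delta> / 2"
    using order_tendstoD(2)[OF LIMSEQ_inverse_real_of_nat, of "\<delta> / 2"] \<delta>(1) by (simp add: field_simps)
  ultimately have "\<forall>\<^sub>F k in sequentially. dist ((p \<circ> s) k) l < \<eta> \<and> k \<ge> N \<and> 1 / real (Suc k) < \<delta> / 2"
    by eventually_elim auto
  then obtain k where k: "dist (p (s k)) l < \<eta>" "k \<ge> N" "1 / real (Suc k) < \<delta> / 2"
    by (auto simp: eventually_sequentially)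
  have sk: "s k \<ge> k" using l(2) by (rule seq_suble)
  have "1 / real (Suc (s k)) \<le> 1 / real (Suc k)" using sk by (simp add: frac_le)
  then have small: "1 / real (Suc (s k)) \<le> \<delta> / 2" using k(3) by linarith
  have "forces \<alpha> \<beta> N (\<lambda>c r. \<forall>x\<in>cball c r. \<bar>f (p (s k)) x\<bar> \<ge> 1 / real (Suc (s k))) 0 1"
    using forces_nested[OF zero_less_one \<delta>(2)]
  proof (rule forces_mono, intro ballI)
    fix c r x
    assume A: "(\<forall>x\<in>cball c r. \<delta> \<le> \<bar>f l x\<bar>) \<and> r = q ^ N * 1 \<and> cball c r \<subseteq> cball 0 1" "x \<in> cball c r"
    then have "\<bar>f (p (s k)) x - f l x\<bar> < \<delta> / 2" using p(1) k(1) by (intro close) auto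
    moreover have "\<delta> \<le> \<bar>f l x\<bar>" using A by blast
    ultimately show "\<bar>f (p (s k)) x\<bar> \<ge> 1 / real (Suc (s k))" using small by linarith
  qed
  \<comment> \<open>The time \<open>N\<close> of the limit is prolonged to \<open>s k\<close>, the
    time at which \<open>p (s k)\<close> is bad.\<close>
  then have "forces \<alpha> \<beta> (s k) (\<lambda>c r. \<forall>x\<in>cball c r. \<bar>f (p (s k)) x\<bar> \<ge> 1 / real (Suc (s k))) 0 1"
    by (rule forces_longer[rotated]) (use sk k(2) in auto)
  then show False using p(2) by (simp add: bad_def)
qed

end

subsection \<open>Transversality to subspaces\<close>

text \<open>Supplies a point at which the determinant polynomial below does not vanish. Let
  \<open>X\<close> be the projection of \<open>M\<close> and \<open>Y\<close> its vertical part.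
  Over \<open>X\<close> the matrix follows a linear section of \<open>M\<close>, moved off
  \<open>M\<close> by an isometry into the orthogonal complement of \<open>Y\<close>; there is room
  for it because dim X + dim Y \<le> m.\<close>

lemma complementary_graph_exists:
  fixes M :: "((real^'n) \<times> (real^'m)) set"
  assumes M: "subspace M" "dim M \<le> CARD('m)"
  shows "\<exists>\<Theta>::real^'n^'m. \<forall>(x, y)\<in>M. y = \<Theta> *v x \<longrightarrow> x = 0 \<and> y = 0"
proof -
  define X where "X = fst ` M"
  define Y where "Y = {y. (0, y) \<in> M}"
  define Y' where "Y' = {y \<in> UNIV. \<forall>x\<in>Y. orthogonal x y}"
  have lin_fst: "linear (fst :: (real^'n) \<times> (real^'m) \<Rightarrow> _)"
    and lin_snd: "linear (snd :: (real^'n) \<times> (real^'m) \<Rightarrow> _)"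
    by (simp_all add: bounded_linear.linear bounded_linear_fst bounded_linear_snd)
  have X: "subspace X" unfolding X_def by (rule linear_subspace_image[OF lin_fst M(1)])
  have lin_in: "linear (\<lambda>y::real^'m. (0::real^'n, y))" by (rule linearI) auto
  have "Y = (\<lambda>y. (0, y)) -` M" by (auto simp: Y_def)
  then have Y: "subspace Y" using linear_subspace_vimage[OF lin_in M(1)] by simp
  have Y': "subspace Y'" by (auto simp: Y'_def subspace_def orthogonal_def inner_add_right)
  obtain g where g: "range g \<subseteq> M" "linear g" "\<And>x. x \<in> X \<Longrightarrow> fst (g x) = x"
  proof -
    have "\<exists>g. range g \<subseteq> M \<and> linear g \<and> (\<forall>x\<in>fst ` M. fst (g x) = x)"
      by (rule linear_exists_right_inverse_on[OF lin_fst M(1)])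
    then show ?thesis by (elim exE conjE) (rule that, auto simp: X_def)
  qed
  have "dim X + dim Y \<le> dim M"
  proof -
    have inj: "inj_on g (span X)" using g(3) X by (metis inj_onI span_eq_iff)
    have inj2: "inj_on (\<lambda>y::real^'m. (0::real^'n, y)) (span Y)" by (auto simp: inj_on_def)
    let ?A = "g ` X" and ?B = "(\<lambda>y. (0 :: real^'n, y)) ` Y"
    have sub: "subspace ?A" "subspace ?B"
      using linear_subspace_image[OF g(2) X] linear_subspace_image[OF lin_in Y] by simp_all
    have "?A \<inter> ?B \<subseteq> {0}"
    proof
      fix z assume "z \<in> ?A \<inter> ?B"
      then obtain x y where "x \<in> X" "z = g x" "z = (0, y)" by auto
      then have "x = 0" using g(3)[of x] by (metis fst_conv)
      then show "z \<in> {0}" using \<open>z = g x\<close> linear_0[OF g(2)] by simp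
    qed
    then have "dim (?A \<inter> ?B) = 0" by (simp add: dim_eq_0)
    moreover have "dim {x + y |x y. x \<in> ?A \<and> y \<in> ?B} \<le> dim M"
    proof (intro dim_subset subsetI)
      fix z assume "z \<in> {x + y |x y. x \<in> ?A \<and> y \<in> ?B}"
      then obtain x y where "z = x + y" "x \<in> ?A" "y \<in> ?B" by blast
      moreover have "?A \<subseteq> M" "?B \<subseteq> M" using g(1) by (auto simp: Y_def)
      ultimately show "z \<in> M" using subspace_add[OF M(1)] by blast
    qed
    moreover have "dim {x + y |x y. x \<in> ?A \<and> y \<in> ?B} + dim (?A \<inter> ?B) = dim ?A + dim ?B"
      by (rule dim_sums_Int[OF sub])
    moreover have "dim ?A = dim X" by (rule dim_image_eq[OF g(2) inj])
    moreover have "dim ?B = dim Y" by (rule dim_image_eq[OF lin_in inj2])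
    ultimately show ?thesis by linarith
  qed
  moreover have "dim Y' + dim Y = CARD('m)"
    using dim_subspace_orthogonal_to_vectors[OF Y subspace_UNIV] by (simp add: Y'_def)
  ultimately have "dim X \<le> dim Y'" using M(2) by linarith
  then obtain f where f: "linear f" "f \<in> X \<rightarrow> Y'" "\<And>x. x \<in> X \<Longrightarrow> norm (f x) = norm x"
    using isometry_subset_subspace[OF X Y'] by blast
  define h where "h x = snd (g x) - f x" for x
  have "linear h"
    unfolding h_def using linear_compose[OF g(2) lin_snd] f(1) by (intro linear_compose_sub) (auto simp: o_def)
  have "x = 0 \<and> y = 0" if xy: "(x, y) \<in> M" "y = matrix h *v x" for x y
  proof -
    have x: "x \<in> X" using xy(1) by (force simp: X_def)
    have "y = snd (g x) - f x" using xy(2) \<open>linear h\<close> by (simp add: matrix_works h_def)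
    \<comment> \<open>Both points lie over \<open>x\<close>, so their difference is vertical; thus
      \<open>- f x\<close> falls into \<open>Y\<close> while \<open>f x\<close> lies in its
      orthogonal complement.\<close>
    moreover have "(x, y) - g x \<in> M" using xy(1) g(1) M(1) by (intro subspace_diff) auto
    then have "(0, y - snd (g x)) \<in> M"
      using g(3)[OF x] by (metis (no_types, lifting) diff_Pair diff_self prod.collapse)
    ultimately have "- f x \<in> Y" by (simp add: Y_def)
    moreover have "f x \<in> Y'" using f(2) x by blast
    ultimately have "orthogonal (- f x) (f x)" by (simp add: Y'_def)
    then have "f x = 0" by (simp add: orthogonal_def)
    then have "x = 0" using f(3)[OF x] by simp
    then show ?thesis using xy(2) by simp
  qed
  then show ?thesis by blast
qed

text \<open>Sends the coordinates of a point (x, y) in the span of \<open>v\<close> to y - \<Theta>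
  x. For independent \<open>v\<close> the determinant vanishes exactly when the graph meets the span
  nontrivially; taking m vectors makes the matrix square.\<close>

definition transversal_matrix :: "((real^'n) \<times> (real^'m))^'m \<Rightarrow> real^'n^'m \<Rightarrow> real^'m^'m" where
  "transversal_matrix v \<Theta> = (\<chi> j k. (snd (v $ k) - \<Theta> *v fst (v $ k)) $ j)"

definition vec_combination :: "'a::real_vector^'m \<Rightarrow> real^'m \<Rightarrow> 'a" where
  "vec_combination v z = (\<Sum>k\<in>UNIV. z $ k *\<^sub>R v $ k)"

text \<open>With m vectors in each tuple, a compact parametrisation of the m-dimensional subspaces
  in place of the Grassmannian. Orthonormality also makes \<open>vec_combination\<close>
  isometric.\<close>

definition orthonormal :: "('a::euclidean_space^'m) set" where
  "orthonormal = {v. \<forall>i j. v $ i \<bullet> v $ j = (if i = j then 1 else 0)}"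

lemma transversal_matrix_mult:
  fixes v :: "((real^'n) \<times> (real^'m))^'m"
  shows "transversal_matrix v \<Theta> *v z =
    snd (vec_combination v z) - \<Theta> *v fst (vec_combination v z)"
proof -
  have "transversal_matrix v \<Theta> *v z = (\<Sum>k\<in>UNIV. z $ k *\<^sub>R (snd (v $ k) - \<Theta> *v fst (v $ k)))"
    by (simp add: vec_eq_iff transversal_matrix_def matrix_vector_mult_def mult.commute)
  also have "\<dots> = (\<Sum>k\<in>UNIV. z $ k *\<^sub>R snd (v $ k)) - \<Theta> *v (\<Sum>k\<in>UNIV. z $ k *\<^sub>R fst (v $ k))"
    by (simp add: linear_sum[OF matrix_vector_mul_linear] scaleR_right_diff_distrib sum_subtractf
        matrix_vector_mult_scaleR)
  also have "\<dots> = snd (vec_combination v z) - \<Theta> *v fst (vec_combination v z)"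
    by (simp add: vec_combination_def fst_sum snd_sum)
  finally show ?thesis .
qed

lemma norm_vec_combination:
  assumes "v \<in> orthonormal"
  shows "norm (vec_combination v z) = norm z"
proof -
  have v: "v $ i \<bullet> v $ j = (if i = j then 1 else 0)" for i j
    using assms by (simp add: orthonormal_def)
  have "vec_combination v z \<bullet> vec_combination v z = z \<bullet> z"
    by (simp add: vec_combination_def v inner_sum_left inner_sum_right inner_vec_def
        if_distrib[of "\<lambda>x. _ * x"] cong: if_cong)
  then show ?thesis by (simp add: norm_eq_sqrt_inner)
qed

lemma compact_orthonormal: "compact (orthonormal :: ('a::euclidean_space^'m) set)"
proof -
  have "orthonormal = (\<Inter>i. \<Inter>j. {v :: 'a^'m. v $ i \<bullet> v $ j = (if i = j then 1 else 0)})"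
    by (auto simp: orthonormal_def)
  moreover have "closed {v :: 'a^'m. v $ i \<bullet> v $ j = (if i = j then 1 else 0)}" for i j
    by (intro closed_Collect_eq continuous_intros)
  ultimately have "closed (orthonormal :: ('a^'m) set)" by (metis (no_types, lifting) closed_INT)
  moreover have "norm v \<le> CARD('m)" if "v \<in> orthonormal" for v :: "'a^'m"
  proof -
    have "norm v \<le> (\<Sum>i\<in>UNIV. norm (v $ i))" by (simp add: norm_vec_def L2_set_le_sum)
    also have "\<dots> = CARD('m)" using that by (simp add: orthonormal_def norm_eq_sqrt_inner)
    finally show ?thesis .
  qed
  then have "bounded (orthonormal :: ('a^'m) set)" by (auto simp: bounded_iff)
  ultimately show ?thesis by (simp add: compact_eq_bounded_closed)
qed

lemma continuous_transversal_matrix: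
  "continuous_on UNIV (\<lambda>p :: (((real^'n) \<times> (real^'m))^'m) \<times> (real^'n^'m). transversal_matrix (fst p) (snd p))"
  unfolding transversal_matrix_def matrix_vector_mult_def
  by (intro continuous_on_vec_lambda) (simp, intro continuous_intros)

lemma continuous_on_det:
  fixes A :: "'a::topological_space \<Rightarrow> real^'k^'k"
  assumes "continuous_on S A"
  shows "continuous_on S (\<lambda>x. det (A x))"
  unfolding det_def by (intro continuous_intros assms)

text \<open>Enlarging \<open>M\<close> to dimension m only strengthens transversality, so that one
  compact parameter space serves all smaller dimensions. An orthonormal basis of \<open>M\<close> is
  completed by one of its orthogonal complement, and m of these vectors, including the basis of
  \<open>M\<close>, are kept.\<close>

lemma subspace_subset_range_orthonormal:
  fixes M :: "'a::euclidean_space set"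
  assumes "subspace M" "dim M \<le> CARD('m)" "CARD('m) \<le> DIM('a)"
  shows "\<exists>v\<in>orthonormal. M \<subseteq> range (vec_combination (v :: 'a^'m))"
proof -
  obtain B where B: "B \<subseteq> M" "pairwise orthogonal B" "\<And>x. x \<in> B \<Longrightarrow> norm x = 1"
    "independent B" "card B = dim M" "span B = M"
    by (rule orthonormal_basis_subspace[OF assms(1)]) blast
  obtain C where C: "pairwise orthogonal C" "\<And>x. x \<in> C \<Longrightarrow> norm x = 1"
     "independent C" "card C = DIM('a)" "C \<supseteq> B"
  proof -
    let ?P = "{y \<in> UNIV. \<forall>x\<in>M. orthogonal x y}"
    have "subspace ?P" by (auto simp: subspace_def orthogonal_def inner_add_right)
    then obtain C where C: "C \<subseteq> ?P" "pairwise orthogonal C" "\<And>x. x \<in> C \<Longrightarrow> norm x = 1"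
      "independent C" "card C = dim ?P" "span C = ?P"
      by (rule orthonormal_basis_subspace) blast
    have o: "orthogonal x y" if "x \<in> B" "y \<in> C" for x y using that B(1) C(1) by auto
    have "B \<inter> C = {}"
    proof (rule ccontr)
      assume "B \<inter> C \<noteq> {}"
      then obtain x where "x \<in> B" "x \<in> C" by blast
      then have "orthogonal x x" "norm x = 1" using o B(3) by blast+
      then show False by (simp add: orthogonal_def)
    qed
    then have "card (B \<union> C) = DIM('a)"
      using dim_subspace_orthogonal_to_vectors[OF assms(1) subspace_UNIV] B(4,5) C(4,5)
      by (simp add: card_Un_disjoint independent_imp_finite)
    moreover have po: "pairwise orthogonal (B \<union> C)"
      using B(2) C(2) o unfolding pairwise_def by (metis Un_iff orthogonal_commute)
    moreover have n: "norm x = 1" if "x \<in> B \<union> C" for x using that B(3) C(3) by blast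
    moreover have "independent (B \<union> C)"
      using po by (rule pairwise_orthogonal_independent) (use n in force)
    ultimately show ?thesis using that[of "B \<union> C"] by blast
  qed
  have "finite C" using C(3) by (rule independent_imp_finite)
  obtain D where D: "B \<subseteq> D" "D \<subseteq> C" "card D = CARD('m)"
    using exists_subset_between[of B "CARD('m)" C] B(5) C(4,5) assms \<open>finite C\<close> by auto
  then have "finite D" using \<open>finite C\<close> finite_subset by blast
  then obtain f :: "'m \<Rightarrow> 'a" where f: "bij_betw f UNIV D"
    using D(3) finite_same_card_bij[of "UNIV :: 'm set" D] by auto
  let ?v = "\<chi> k. f k"
  have inj: "inj f" and ran: "range f = D" using f by (auto simp: bij_betw_def)
  have "f i \<bullet> f j = (if i = j then 1 else 0)" for i j
  proof (cases "i = j")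
    case True
    have "f i \<in> C" using ran D(2) by blast
    then show ?thesis using True C(2)[of "f i"] by (simp add: norm_eq_1)
  next
    case False
    then have "f i \<noteq> f j" "f i \<in> C" "f j \<in> C" using inj ran D(2) by (auto simp: inj_def)
    then show ?thesis using C(1) False by (auto simp: pairwise_def orthogonal_def)
  qed
  then have "?v \<in> orthonormal" by (simp add: orthonormal_def)
  moreover have "M \<subseteq> range (vec_combination ?v)"
  proof -
    have lin: "linear (vec_combination ?v)"
      by (rule linearI) (simp_all add: vec_combination_def scaleR_add_left sum.distrib scaleR_sum_right)
    have "f k \<in> range (vec_combination ?v)" for k
      by (rule range_eqI[of _ _ "axis k 1"])
        (simp add: vec_combination_def axis_def if_distrib[of "\<lambda>x. x *\<^sub>R _"] cong: if_cong)
    then have "B \<subseteq> range (vec_combination ?v)" using D(1) ran by blast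
    then have "span B \<subseteq> range (vec_combination ?v)"
      by (rule span_minimal) (rule linear_subspace_image[OF lin subspace_UNIV])
    then show ?thesis using B(6) by simp
  qed
  ultimately show ?thesis by blast
qed

context schmidt_game
begin

lemma forceable_transversal:
  fixes v :: "((real^'n) \<times> (real^'m))^'m"
  assumes v: "v \<in> orthonormal"
  shows "forceable (\<lambda>\<Theta>. det (transversal_matrix v \<Theta>))"
proof -
  let ?M = "range (vec_combination v)"
  have lin: "linear (vec_combination v)"
    by (rule linearI) (simp_all add: vec_combination_def scaleR_add_left sum.distrib scaleR_sum_right)
  have "dim ?M \<le> CARD('m)" using dim_image_le[OF lin, of UNIV] by simp
  then obtain \<Theta> where \<Theta>: "\<And>x y. (x, y) \<in> ?M \<Longrightarrow> y = \<Theta> *v x \<Longrightarrow> x = 0 \<and> y = 0"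
    using complementary_graph_exists[OF linear_subspace_image[OF lin subspace_UNIV]] by blast
  have "z = 0" if "transversal_matrix v \<Theta> *v z = 0" for z
  proof -
    have "(fst (vec_combination v z), snd (vec_combination v z)) \<in> ?M" by simp
    moreover have "snd (vec_combination v z) = \<Theta> *v fst (vec_combination v z)"
      using that by (simp add: transversal_matrix_mult)
    ultimately have "vec_combination v z = 0" using \<Theta> by (metis prod.collapse zero_prod_def)
    then show ?thesis using norm_vec_combination[OF v, of z] by simp
  qed
  then have "invertible (transversal_matrix v \<Theta>)"
    by (simp add: invertible_left_inverse matrix_left_invertible_ker)
  then have "det (transversal_matrix v \<Theta>) \<noteq> 0" by (simp add: invertible_det_nz)
  moreover have "\<exists>D. poly_deg D (\<lambda>\<Theta>. det (transversal_matrix v \<Theta>))"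
  proof (rule poly_deg_det)
    fix j k :: 'm
    \<comment> \<open>The coefficient matrix of the linear part of an entry, which is affine in
      \<Theta>.\<close>
    let ?a = "\<chi> j'. if j' = j then - fst (v $ k) else 0"
    have "?a \<bullet> \<Theta> = - (\<Theta> $ j \<bullet> fst (v $ k))" for \<Theta> :: "real^'n^'m"
    proof -
      have "?a \<bullet> \<Theta> = (\<Sum>i\<in>UNIV. if i = j then - (\<Theta> $ j \<bullet> fst (v $ k)) else 0)"
        unfolding inner_vec_def[of ?a] by (intro sum.cong) (auto simp: inner_commute)
      then show ?thesis by simp
    qed
    then have "(\<lambda>\<Theta>. transversal_matrix v \<Theta> $ j $ k) = (\<lambda>\<Theta>. ?a \<bullet> \<Theta> + snd (v $ k) $ j)"
      by (simp add: fun_eq_iff transversal_matrix_def matrix_vector_mult_def inner_vec_def)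
    then show "\<exists>D. poly_deg D (\<lambda>\<Theta>. transversal_matrix v \<Theta> $ j $ k)"
      using poly_deg_affine[of ?a] by metis
  qed
  ultimately show ?thesis using forceable_polynomial by blast
qed

text \<open>A lower bound for the determinant is converted into one for the expansion of vectors. A
  second compactness argument, over \<open>v\<close>, \<Theta> and unit vectors \<open>z\<close>
  together, makes it uniform.\<close>

lemma forces_transversal_unit:
  "\<exists>N. \<exists>\<kappa>>0. \<forall>v\<in>orthonormal. forces \<alpha> \<beta> N (\<lambda>c r. \<forall>\<Theta>\<in>cball c r. \<forall>z.
     norm (transversal_matrix v \<Theta> *v z) \<ge> \<kappa> * norm z) (0 :: real^'n^'m) 1"
proof -
  have "continuous_on UNIV (\<lambda>p :: (((real^'n) \<times> (real^'m))^'m) \<times> (real^'n^'m).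
      det (transversal_matrix (fst p) (snd p)))"
    by (rule continuous_on_det[OF continuous_transversal_matrix])
  then have cont: "continuous_on S (\<lambda>p :: (((real^'n) \<times> (real^'m))^'m) \<times> (real^'n^'m).
      det (transversal_matrix (fst p) (snd p)))" for S
    by (rule continuous_on_subset) simp
  obtain N \<delta> where N: "\<delta> > 0" "\<And>v. v \<in> orthonormal \<Longrightarrow>
      forces \<alpha> \<beta> N (\<lambda>c r. \<forall>\<Theta>\<in>cball c r. \<bar>det (transversal_matrix v \<Theta>)\<bar> \<ge> \<delta>) (0 :: real^'n^'m) 1"
  proof -
    have "\<exists>N. \<exists>\<delta>>0. \<forall>v\<in>orthonormal. forces \<alpha> \<beta> N
        (\<lambda>c r. \<forall>\<Theta>\<in>cball c r. \<bar>det (transversal_matrix v \<Theta>)\<bar> \<ge> \<delta>) (0 :: real^'n^'m) 1"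
      by (rule forceable_uniform[OF compact_orthonormal])
        (use cont forceable_transversal in \<open>auto simp: case_prod_unfold\<close>)
    then show ?thesis using that by blast
  qed
  define K where "K = (orthonormal \<times> cball 0 1 \<times> sphere 0 1) \<inter>
    {p :: (((real^'n) \<times> (real^'m))^'m) \<times> (real^'n^'m) \<times> (real^'m).
      \<delta> \<le> \<bar>det (transversal_matrix (fst p) (fst (snd p)))\<bar>}"
  define F where "F p = norm (transversal_matrix (fst p) (fst (snd p)) *v (snd (snd p)))"
    for p :: "(((real^'n) \<times> (real^'m))^'m) \<times> (real^'n^'m) \<times> (real^'m)"
  have c: "continuous_on UNIV (\<lambda>p :: (((real^'n) \<times> (real^'m))^'m) \<times> (real^'n^'m) \<times> (real^'m).
      transversal_matrix (fst p) (fst (snd p)))"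
    using continuous_on_compose2[OF continuous_transversal_matrix,
        of UNIV "\<lambda>p. (fst p, fst (snd p))"] by (simp add: continuous_on_Pair continuous_on_fst continuous_on_snd)
  have "compact K"
    unfolding K_def using c
    by (intro compact_Int_closed compact_Times compact_orthonormal closed_Collect_le
        continuous_intros continuous_on_det) auto
  have cF: "continuous_on K F"
  proof -
    have "continuous_on UNIV F"
      unfolding F_def matrix_vector_mult_def using c
      by (intro continuous_on_norm continuous_on_vec_lambda continuous_intros) auto
    then show ?thesis by (rule continuous_on_subset) simp
  qed
  have pos: "F p > 0" if "p \<in> K" for p
  proof -
    have "det (transversal_matrix (fst p) (fst (snd p))) \<noteq> 0" using that N(1) by (auto simp: K_def)
    then have "\<forall>z. transversal_matrix (fst p) (fst (snd p)) *v z = 0 \<longrightarrow> z = 0"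
      using invertible_det_nz invertible_left_inverse matrix_left_invertible_ker by blast
    moreover have "snd (snd p) \<noteq> 0" using that by (auto simp: K_def)
    ultimately show ?thesis by (auto simp: F_def)
  qed
  obtain \<kappa> where \<kappa>: "\<kappa> > 0" "\<And>p. p \<in> K \<Longrightarrow> F p \<ge> \<kappa>"
  proof (cases "K = {}")
    case True
    then show ?thesis using that[of 1] by auto
  next
    case False
    then obtain p where "p \<in> K" "\<And>p'. p' \<in> K \<Longrightarrow> F p \<le> F p'"
      using continuous_attains_inf[OF \<open>compact K\<close> False cF] by blast
    then show ?thesis using that[of "F p"] pos by blast
  qed
  have "forces \<alpha> \<beta> N (\<lambda>c r. \<forall>\<Theta>\<in>cball c r. \<forall>z.
     norm (transversal_matrix v \<Theta> *v z) \<ge> \<kappa> * norm z) (0 :: real^'n^'m) 1" if v: "v \<in> orthonormal" for v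
    using forces_nested[OF zero_less_one N(2)[OF v]]
  proof (rule forces_mono, intro ballI allI)
    fix c :: "real^'n^'m" and r \<Theta> z
    assume A: "(\<forall>\<Theta>\<in>cball c r. \<delta> \<le> \<bar>det (transversal_matrix v \<Theta>)\<bar>) \<and> r = q ^ N * 1 \<and>
      cball c r \<subseteq> cball 0 1" "\<Theta> \<in> cball c r"
    show "norm (transversal_matrix v \<Theta> *v z) \<ge> \<kappa> * norm z"
    proof (cases "z = 0")
      case False
      have "\<Theta> \<in> cball 0 1" "\<delta> \<le> \<bar>det (transversal_matrix v \<Theta>)\<bar>" using A by blast+
      then have "(v, \<Theta>, z /\<^sub>R norm z) \<in> K" using v False by (simp add: K_def)
      from \<kappa>(2)[OF this] have "\<kappa> \<le> norm (transversal_matrix v \<Theta> *v z) / norm z"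
        by (simp add: F_def matrix_vector_mult_scaleR divide_inverse mult.commute)
      then show ?thesis using False by (simp add: pos_le_divide_eq)
    qed simp
  qed
  then show ?thesis using \<kappa>(1) by blast
qed

text \<open>The unit ball case, rescaled. The point is that \<open>N\<close> and
  \<open>\<kappa>\<close> do not depend on \<open>M\<close>, \<open>c\<close> or
  \<open>r\<close>.\<close>

lemma forces_transversal:
  "\<exists>N. \<exists>\<kappa>>0. \<forall>M c r. subspace M \<longrightarrow> dim M \<le> CARD('m) \<longrightarrow> r > 0 \<longrightarrow>
     forces \<alpha> \<beta> N (\<lambda>c' r'. \<forall>\<Theta>\<in>cball c' r'. \<forall>(x, y)\<in>M.
       norm (y - \<Theta> *v x) \<ge> \<kappa> * norm (r *\<^sub>R x, y - c *v x)) (c :: real^'n^'m) r"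
proof -
  obtain N \<kappa> where N: "\<kappa> > 0" "\<And>v. v \<in> orthonormal \<Longrightarrow> forces \<alpha> \<beta> N (\<lambda>c r. \<forall>\<Theta>\<in>cball c r. \<forall>z.
     norm (transversal_matrix v \<Theta> *v z) \<ge> \<kappa> * norm z) (0 :: real^'n^'m) 1"
    using forces_transversal_unit by blast
  have "forces \<alpha> \<beta> N (\<lambda>c' r'. \<forall>\<Theta>\<in>cball c' r'. \<forall>(x, y)\<in>M.
       norm (y - \<Theta> *v x) \<ge> \<kappa> * norm (r *\<^sub>R x, y - c *v x)) c r"
    if M: "subspace M" "dim M \<le> CARD('m)" and r: "r > 0" for M and c :: "real^'n^'m" and r
  proof -
    \<comment> \<open>For \<Theta> = c + r h this map carries the graph of \<Theta> to that of
      \<open>h\<close>, because y - \<Theta> x = (y - c x) - h (r x).\<close>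
    define T where "T = (\<lambda>(x, y). (r *\<^sub>R x, y - c *v x))"
    have "linear T" by (rule linearI) (auto simp: T_def algebra_simps matrix_vector_right_distrib
          matrix_vector_mult_scaleR)
    then have "subspace (T ` M)" "dim (T ` M) \<le> CARD('m)"
      using M linear_subspace_image dim_image_le[of T M] by (blast, linarith)
    then obtain v :: "((real^'n) \<times> (real^'m))^'m" where v: "v \<in> orthonormal" "T ` M \<subseteq> range (vec_combination v)"
      using subspace_subset_range_orthonormal[of "T ` M", where 'm = 'm] by auto
    show ?thesis
      using r forces_nested[OF zero_less_one N(2)[OF v(1)]]
    proof (rule forces_affine[OF _ forces_mono], intro ballI)
      fix c' :: "real^'n^'m" and r' \<Theta> p
      assume A: "(\<forall>\<Theta>\<in>cball c' r'. \<forall>z. \<kappa> * norm z \<le> norm (transversal_matrix v \<Theta> *v z)) \<and>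
         r' = q ^ N * 1 \<and> cball c' r' \<subseteq> cball 0 1"
        and \<Theta>: "\<Theta> \<in> cball (c + r *\<^sub>R c') (r * r')" and p: "p \<in> M"
      obtain x y where xy: "p = (x, y)" by (cases p)
      define h where "h = (\<Theta> - c) /\<^sub>R r"
      have h: "\<Theta> = c + r *\<^sub>R h" using r by (simp add: h_def)
      have "dist (c + r *\<^sub>R c') (c + r *\<^sub>R h) = r * dist c' h"
        using r by (simp add: dist_norm flip: scaleR_right_diff_distrib)
      then have "h \<in> cball c' r'" using \<Theta> r by (simp add: h)
      obtain z where z: "T (x, y) = vec_combination v z" using v(2) p xy by blast
      have "\<kappa> * norm z \<le> norm (transversal_matrix v h *v z)" using A \<open>h \<in> cball c' r'\<close> by blast
      also have "transversal_matrix v h *v z = y - \<Theta> *v x"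
        unfolding transversal_matrix_mult z[symmetric]
        by (simp add: T_def h matrix_vector_mult_add_rdistrib matrix_vector_mult_scaleR scaleR_matrix_vector_assoc)
      also have "norm z = norm (T (x, y))" using norm_vec_combination[OF v(1)] z by simp
      finally show "case p of (x, y) \<Rightarrow> \<kappa> * norm (r *\<^sub>R x, y - c *v x) \<le> norm (y - \<Theta> *v x)"
        by (simp add: T_def xy)
    qed
  qed
  then show ?thesis using N(1) by blast
qed

end

subsection \<open>Short vectors of a lattice and its dual\<close>

lemma emeasure_lborel_affine_vimage:
  fixes U :: "'a::euclidean_space set"
  assumes "b > 0" "U \<in> sets borel"
  shows "emeasure lborel U = ennreal (b ^ DIM('a)) * emeasure lborel ((\<lambda>y. t + b *\<^sub>R y) -` U)"
proof -
  have "emeasure lborel U =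
      emeasure (density (distr lborel borel (\<lambda>y. t + b *\<^sub>R y)) (\<lambda>_. ennreal (\<bar>b\<bar> ^ DIM('a)))) U"
    using lborel_affine[of b t] assms(1) by simp
  also have "\<dots> = ennreal (b ^ DIM('a)) * emeasure lborel ((\<lambda>y. t + b *\<^sub>R y) -` U)"
    using assms by (simp add: emeasure_density nn_integral_cmult_indicator emeasure_distr)
  finally show ?thesis .
qed

lemma nn_integral_lborel_scaleR:
  fixes g :: "'a::euclidean_space \<Rightarrow> ennreal"
  assumes "a > 0" and [measurable]: "g \<in> borel_measurable borel"
  shows "(\<integral>\<^sup>+x. g x \<partial>lborel) = ennreal (a ^ DIM('a)) * (\<integral>\<^sup>+x. g (a *\<^sub>R x) \<partial>lborel)"
proof -
  have "(\<integral>\<^sup>+x. g x \<partial>lborel) =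
      (\<integral>\<^sup>+x. g x \<partial>density (distr lborel borel (\<lambda>y. 0 + a *\<^sub>R y)) (\<lambda>_. ennreal (\<bar>a\<bar> ^ DIM('a))))"
    using lborel_affine[of a "0 :: 'a"] assms(1) by simp
  also have "\<dots> = ennreal (a ^ DIM('a)) * (\<integral>\<^sup>+x. g (a *\<^sub>R x) \<partial>lborel)"
    using assms(1) by (simp add: nn_integral_density nn_integral_distr nn_integral_cmult)
  finally show ?thesis .
qed

text \<open>Fubini along the first component: on each slice the shear is a translation, so only the
  two scalings affect the volume, and their factors cancel.\<close>

lemma emeasure_scaled_shear_vimage:
  fixes L :: "'a::euclidean_space \<Rightarrow> 'b::euclidean_space"
  assumes L: "linear L" and ab: "a > 0" "b > 0" "a ^ DIM('a) * b ^ DIM('b) = 1"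
    and S[measurable]: "S \<in> sets borel"
  shows "emeasure lborel ((\<lambda>(x, y). (a *\<^sub>R x, b *\<^sub>R (y - L x))) -` S) = emeasure lborel S"
proof -
  let ?f = "\<lambda>(x, y). (a *\<^sub>R x, b *\<^sub>R (y - L x))"
  have cL: "continuous_on UNIV L" using L by (rule linear_continuous_on[OF linear_conv_bounded_linear[THEN iffD1]])
  have "continuous_on UNIV ?f"
    unfolding case_prod_unfold
    by (intro continuous_intros continuous_on_compose2[OF cL]) auto
  then have "?f \<in> borel_measurable borel" by (rule borel_measurable_continuous_onI)
  then have fS: "?f -` S \<in> sets borel" using measurable_sets_borel S by blast
  have prod: "S' \<in> sets (lborel \<Otimes>\<^sub>M lborel)" if "S' \<in> sets borel" for S' :: "('a \<times> 'b) set"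
    using that by (metis lborel_prod sets_lborel)
  have alt: "emeasure lborel S' = (\<integral>\<^sup>+x. emeasure lborel (Pair x -` S') \<partial>lborel)"
    if "S' \<in> sets borel" for S' :: "('a \<times> 'b) set"
    using lborel.emeasure_pair_measure_alt[OF prod[OF that]] by (simp add: lborel_prod)
  have slice: "Pair x -` S' \<in> sets borel" if "S' \<in> sets borel" for S' :: "('a \<times> 'b) set" and x
    using sets_Pair1[OF prod[OF that]] by simp
  define g where "g x = emeasure lborel (Pair x -` S)" for x
  have g[measurable]: "g \<in> borel_measurable borel"
    using lborel.measurable_emeasure_Pair[OF prod[OF S]] by (simp add: g_def[abs_def])
  define h where "h x = emeasure lborel (Pair x -` (?f -` S))" for x
  have h[measurable]: "h \<in> borel_measurable borel"
    using lborel.measurable_emeasure_Pair[OF prod[OF fS]] by (simp add: h_def[abs_def])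
  have gh: "g (a *\<^sub>R x) = ennreal (b ^ DIM('b)) * h x" for x
  proof -
    have "Pair x -` (?f -` S) = (\<lambda>y. - b *\<^sub>R L x + b *\<^sub>R y) -` (Pair (a *\<^sub>R x) -` S)"
      by (auto simp: algebra_simps)
    then show ?thesis unfolding g_def h_def
      using emeasure_lborel_affine_vimage[OF ab(2) slice[OF S], of "a *\<^sub>R x" "- b *\<^sub>R L x"] by simp
  qed
  have "emeasure lborel S = (\<integral>\<^sup>+x. g x \<partial>lborel)" using alt[OF S] by (simp add: g_def)
  also have "\<dots> = ennreal (a ^ DIM('a)) * (\<integral>\<^sup>+x. g (a *\<^sub>R x) \<partial>lborel)"
    by (rule nn_integral_lborel_scaleR[OF ab(1) g])
  also have "\<dots> = ennreal (a ^ DIM('a)) * (ennreal (b ^ DIM('b)) * (\<integral>\<^sup>+x. h x \<partial>lborel))"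
    by (simp add: gh nn_integral_cmult)
  also have "\<dots> = ennreal (a ^ DIM('a)) * ennreal (b ^ DIM('b)) * (\<integral>\<^sup>+x. h x \<partial>lborel)"
    by (simp only: mult.assoc)
  also have "ennreal (a ^ DIM('a)) * ennreal (b ^ DIM('b)) = 1" using ab by (simp flip: ennreal_mult)
  also have "1 * (\<integral>\<^sup>+x. h x \<partial>lborel) = emeasure lborel (?f -` S)" using alt[OF fS] by (simp add: h_def)
  finally show ?thesis by simp
qed

lemma countable_integer_vectors: "countable {z :: 'a::euclidean_space. integer_vector z}"
proof -
  let ?F = "\<lambda>k. \<Sum>b\<in>Basis. of_int (k b) *\<^sub>R (b :: 'a)"
  have "{z :: 'a. integer_vector z} \<subseteq> ?F ` (PiE Basis (\<lambda>_. UNIV :: int set))"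
  proof
    fix z :: 'a assume z: "z \<in> {z. integer_vector z}"
    have "z = (\<Sum>b\<in>Basis. (z \<bullet> b) *\<^sub>R b)" by (simp add: euclidean_representation)
    also have "\<dots> = ?F (restrict (\<lambda>b. \<lfloor>z \<bullet> b\<rfloor>) Basis)"
      using z by (intro sum.cong) (auto simp: integer_vector_def)
    finally have "z = ?F (restrict (\<lambda>b. \<lfloor>z \<bullet> b\<rfloor>) Basis)" .
    then show "z \<in> ?F ` (PiE Basis (\<lambda>_. UNIV :: int set))"
      by (intro image_eqI[where x = "restrict (\<lambda>b. \<lfloor>z \<bullet> b\<rfloor>) Basis"]) auto
  qed
  moreover have "countable (PiE (Basis :: 'a set) (\<lambda>_. UNIV :: int set))"
    by (intro countable_PiE) auto
  ultimately show ?thesis by (rule countable_subset[OF _ countable_image])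
qed

text \<open>Cut \<open>S\<close> along the integer cells and translate each piece \<open>A z\<close>
  to \<open>T z\<close> in the half-open unit cell \<open>Q\<close>. If no two points of
  \<open>S\<close> differ by a nonzero integer vector, the translates are disjoint, and
  \<open>S\<close> has measure at most 1.\<close>

lemma blichfeldt:
  fixes S :: "'a::euclidean_space set"
  assumes S[measurable]: "S \<in> sets borel" and "emeasure lborel S > 1"
  shows "\<exists>x\<in>S. \<exists>y\<in>S. x \<noteq> y \<and> integer_vector (x - y)"
proof (rule ccontr)
  assume neg: "\<not> ?thesis"
  define fl where "fl x = (\<Sum>b\<in>Basis. of_int \<lfloor>x \<bullet> b\<rfloor> *\<^sub>R b)" for x :: 'a
  have fl_inner: "fl x \<bullet> b = of_int \<lfloor>x \<bullet> b\<rfloor>" if "b \<in> Basis" for x b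
    using that by (simp add: fl_def inner_sum_left inner_Basis if_distrib cong: if_cong)
  have [measurable]: "fl \<in> borel_measurable borel"
    unfolding fl_def[abs_def] by (intro borel_measurable_sum borel_measurable_scaleR) measurable
  define Z where "Z = {z :: 'a. integer_vector z}"
  have Z: "countable Z" unfolding Z_def by (rule countable_integer_vectors)
  have flZ: "fl x \<in> Z" for x by (simp add: Z_def integer_vector_def fl_inner)
  have fl_add: "fl (z + x) = z + fl x" if "z \<in> Z" for z x
  proof (rule euclidean_eqI)
    fix b :: 'a assume b: "b \<in> Basis"
    then have "z \<bullet> b \<in> \<int>" using that by (simp add: Z_def integer_vector_def)
    then obtain k where "z \<bullet> b = of_int k" by (rule Ints_cases)
    then show "fl (z + x) \<bullet> b = (z + fl x) \<bullet> b" using b by (simp add: fl_inner inner_add_left)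
  qed
  define Q where "Q = {x. fl x = 0}"
  define A where "A z = {x \<in> S. fl x = z}" for z
  define T where "T z = {x \<in> Q. z + x \<in> S}" for z
  have [measurable]: "A z \<in> sets borel" "T z \<in> sets borel" "Q \<in> sets borel" for z
    unfolding A_def T_def Q_def by measurable
  have AT: "emeasure lborel (T z) = emeasure lborel (A z)" if "z \<in> Z" for z
  proof -
    have "T z = (\<lambda>x. z + 1 *\<^sub>R x) -` A z"
      using fl_add[OF that] by (auto simp: T_def A_def Q_def)
    then show ?thesis using emeasure_lborel_affine_vimage[of 1 "A z" z] by simp
  qed
  have "emeasure lborel S = emeasure lborel (\<Union>z\<in>Z. A z)"
    using flZ by (intro arg_cong[where f = "emeasure lborel"]) (auto simp: A_def)
  also have "\<dots> = (\<integral>\<^sup>+z. emeasure lborel (A z) \<partial>count_space Z)"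
    using Z by (intro emeasure_UN_countable) (auto simp: disjoint_family_on_def A_def)
  also have "\<dots> = (\<integral>\<^sup>+z. emeasure lborel (T z) \<partial>count_space Z)"
    using AT by (intro nn_integral_cong) auto
  also have "\<dots> = emeasure lborel (\<Union>z\<in>Z. T z)"
  proof (rule emeasure_UN_countable[symmetric])
    show "disjoint_family_on T Z"
      unfolding disjoint_family_on_def
    proof (intro ballI impI)
      fix z z' assume z: "z \<in> Z" "z' \<in> Z" "z \<noteq> z'"
      have "integer_vector (z - z')" using z by (auto simp: Z_def integer_vector_def inner_diff_left)
      then have "z + x \<notin> S \<or> z' + x \<notin> S" for x
        using neg z(3) by (metis add_diff_cancel_right add_right_imp_eq)
      then show "T z \<inter> T z' = {}" by (auto simp: T_def)
    qed
  qed (use Z in auto)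
  also have "\<dots> \<le> emeasure lborel Q" by (intro emeasure_mono) (auto simp: T_def)
  also have "\<dots> \<le> emeasure lborel (cbox (0::'a) One)"
  proof (intro emeasure_mono subsetI)
    fix x assume x: "x \<in> Q"
    have "0 \<le> x \<bullet> b \<and> x \<bullet> b \<le> 1" if b: "b \<in> Basis" for b
    proof -
      have "\<lfloor>x \<bullet> b\<rfloor> = 0" using x fl_inner[OF b, of x] by (simp add: Q_def)
      then show ?thesis by linarith
    qed
    then show "x \<in> cbox 0 One" by (simp add: mem_box)
  qed simp
  also have "\<dots> = 1" by (simp add: emeasure_lborel_cbox_eq)
  finally show False using assms(2) by simp
qed

section \<open>Duality between \<Theta> and its transpose\<close>

text \<open>If the current ball has radius \<open>\<theta>\<^sup>n\<^sup>+\<^sup>m\<close>, then \<open>scaled_forms\<close> is the unimodular renormalisation under which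
  changing \<open>\<Theta>\<close> within the ball perturbs the lattice by a bounded amount. The threshold \<open>\<delta>\<^sup>n\<close> for \<open>\<Theta>\<close> becomes
  \<open>\<delta>\<^sup>m\<close> for the transpose; with these exponents each of the two conditions controls the other one's
  short vectors once \<open>\<delta>\<close> is small.\<close>

definition scaled_forms :: "real^'n^'m \<Rightarrow> real \<Rightarrow> (real^'n) \<times> (real^'m) \<Rightarrow> (real^'n) \<times> (real^'m)" where
  "scaled_forms \<Theta> \<theta> = (\<lambda>(x, y). (\<theta> ^ CARD('m) *\<^sub>R x, (1 / \<theta> ^ CARD('n)) *\<^sub>R (y - \<Theta> *v x)))"

definition well_spaced :: "real^'n^'m \<Rightarrow> real \<Rightarrow> real \<Rightarrow> bool" where
  "well_spaced \<Theta> \<theta> \<delta> \<longleftrightarrow>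
    (\<forall>X. integer_vector X \<longrightarrow> X \<noteq> 0 \<longrightarrow> \<delta> ^ CARD('n) \<le> norm (scaled_forms \<Theta> \<theta> X))"

text \<open>When the scaled forms of the transpose are paired with the flipped scaled forms of
  \<Theta>, the terms containing \<Theta> cancel and so do the powers of \<theta>. This makes the
  two lattices dual to each other.\<close>

definition symplectic_flip :: "'a \<times> 'b \<Rightarrow> 'b \<times> 'a::real_vector" where
  "symplectic_flip = (\<lambda>(x, y). (y, - x))"

lemma linear_scaled_forms: "linear (scaled_forms \<Theta> \<theta>)"
  by (rule linearI) (auto simp: scaled_forms_def algebra_simps matrix_vector_right_distrib
      matrix_vector_mult_scaleR)

lemma scaled_forms_eq_0_iff: "\<theta> > 0 \<Longrightarrow> scaled_forms \<Theta> \<theta> X = 0 \<longleftrightarrow> X = 0"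
  by (auto simp: scaled_forms_def zero_prod_def split: prod.splits)

lemma linear_symplectic_flip:
  "linear (symplectic_flip :: 'a::real_vector \<times> 'b::real_vector \<Rightarrow> 'b \<times> 'a)"
  by (rule linearI) (auto simp: symplectic_flip_def)

lemma norm_symplectic_flip [simp]:
  fixes X :: "'a::real_normed_vector \<times> 'b::real_normed_vector"
  shows "norm (symplectic_flip X) = norm X"
  by (simp add: symplectic_flip_def norm_prod_def add.commute split: prod.split)

lemma scaled_forms_pairing:
  fixes \<Theta> :: "real^'n^'m"
  assumes "\<theta> > 0"
  shows "scaled_forms (transpose \<Theta>) \<theta> Y \<bullet> symplectic_flip (scaled_forms \<Theta> \<theta> X) = Y \<bullet> symplectic_flip X"
proof -
  obtain x y \<eta> \<xi> where XY: "X = (x, y)" "Y = (\<eta>, \<xi>)" by (cases X, cases Y)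
  have "(transpose \<Theta> *v \<eta>) \<bullet> x = \<eta> \<bullet> (\<Theta> *v x)" by (simp add: dot_lmul_matrix)
  then show ?thesis
    using assms by (simp add: XY scaled_forms_def symplectic_flip_def inner_diff_left inner_diff_right
        right_diff_distrib diff_divide_distrib)
qed

lemma integer_vector_Pair_iff: "integer_vector (x, y) \<longleftrightarrow> integer_vector x \<and> integer_vector y"
  by (simp add: integer_vector_def Basis_prod_def ball_Un)

lemma integer_vector_inner:
  fixes u v :: "'a::euclidean_space"
  assumes "integer_vector u" "integer_vector v"
  shows "u \<bullet> v \<in> \<int>"
  using assms by (subst euclidean_inner) (auto simp: integer_vector_def intro!: Ints_sum Ints_mult)

lemma integer_vector_pairing:
  fixes X :: "(real^'n) \<times> (real^'m)"
  assumes "integer_vector X" "integer_vector Y"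
  shows "Y \<bullet> symplectic_flip X \<in> \<int>"
proof -
  obtain x y \<eta> \<xi> where XY: "X = (x, y)" "Y = (\<eta>, \<xi>)" by (cases X, cases Y)
  have "integer_vector x" "integer_vector y" "integer_vector \<eta>" "integer_vector \<xi>"
    using assms by (auto simp: XY integer_vector_Pair_iff)
  then show ?thesis by (auto simp: XY symplectic_flip_def intro!: Ints_diff integer_vector_inner)
qed

text \<open>Packing balls along the span \<open>V\<close> of the short vectors and applying Blichfeldt's lemma gives
  a nonzero vector of the dual lattice that is close to \<open>V\<close>. Its pairings with the short vectors are
  integers smaller than 1, so that it is orthogonal to \<open>V\<close>, hence short.\<close>

lemma short_dual_vector:
  fixes \<Theta> :: "real^'n^'m"
  assumes \<theta>: "\<theta> > 0" and s: "s > 0" and "r \<ge> 0"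
    and dim: "dim {X. integer_vector X \<and> norm (scaled_forms \<Theta> \<theta> X) \<le> r} > CARD('m)"
    and small: "2 * s * (real L * (CARD('m) + 1) + 1) * r < 1"
    and large: "real L ^ (CARD('m) + 1) * (unit_ball_vol (CARD('n) + CARD('m)) * s ^ (CARD('n) + CARD('m))) > 1"
  shows "\<exists>Y. integer_vector Y \<and> Y \<noteq> 0 \<and> norm (scaled_forms (transpose \<Theta>) \<theta> Y) \<le> 2 * s"
proof -
  define A where "A = {X. integer_vector X \<and> norm (scaled_forms \<Theta> \<theta> X) \<le> r}"
  define F where "F X = symplectic_flip (scaled_forms \<Theta> \<theta> X)" for X
  have lF: "linear F"
    unfolding F_def[abs_def] using linear_compose[OF linear_scaled_forms linear_symplectic_flip]
    by (simp add: o_def)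
  have F0: "F X = 0 \<Longrightarrow> X = 0" for X
    using scaled_forms_eq_0_iff[OF \<theta>] norm_symplectic_flip unfolding F_def by (metis norm_eq_zero)
  have "inj F" using lF F0 by (simp add: linear_injective_0)
  then have "dim (F ` A) = dim A"
    by (intro dim_image_eq[OF lF]) (auto intro: inj_on_subset)
  then have dF: "dim (span (F ` A)) > CARD('m)" using dim by (simp add: A_def)
  obtain B where B: "B \<subseteq> span (F ` A)" "pairwise orthogonal B" "\<And>x. x \<in> B \<Longrightarrow> norm x = 1"
    "card B = dim (span (F ` A))"
    by (rule orthonormal_basis_subspace[OF subspace_span[of "F ` A"]]) blast
  obtain E where E: "E \<subseteq> B" "card E = CARD('m) + 1" "finite E"
    using dF B(4) by (metis Suc_eq_plus1 Suc_leI obtain_subset_with_card_n)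
  have on: "e \<bullet> e' = (if e = e' then 1 else 0)" if "e \<in> E" "e' \<in> E" for e e'
  proof -
    have "e \<in> B" "e' \<in> B" using that E(1) by auto
    then show ?thesis using B(2) B(3)[of e] unfolding pairwise_def orthogonal_def norm_eq_1 by auto
  qed
  \<comment> \<open>A cubical grid of spacing 2 s in the m + 1 directions of \<open>E\<close>: open
    balls of radius \<open>s\<close> around its points are disjoint and stay within \<open>s\<close>
    of the span.\<close>
  define p where "p k = (\<Sum>e\<in>E. (2 * s * real (k e)) *\<^sub>R e)" for k
  define I where "I = PiE E (\<lambda>_. {..<L})"
  have finI: "finite I" using E(3) by (simp add: I_def finite_PiE)
  have cardI: "card I = L ^ (CARD('m) + 1)" using E by (simp add: I_def card_PiE)
  have p_inner: "p k \<bullet> e = 2 * s * real (k e)" if "e \<in> E" for k e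
    using that E(3) by (simp add: p_def inner_sum_left on if_distrib cong: if_cong)
  have disj: "disjoint_family_on (\<lambda>k. ball (p k) s) I"
    unfolding disjoint_family_on_def
  proof (intro ballI impI)
    fix k k' assume k: "k \<in> I" "k' \<in> I" "k \<noteq> k'"
    then obtain e where e: "e \<in> E" "k e \<noteq> k' e" unfolding I_def by (metis PiE_ext)
    have "1 \<le> \<bar>real (k e) - real (k' e)\<bar>" using e(2) by linarith
    then have "2 * s \<le> 2 * s * \<bar>real (k e) - real (k' e)\<bar>" using s by simp
    also have "\<dots> = \<bar>(p k - p k') \<bullet> e\<bar>"
      using s e(1) by (simp add: inner_diff_left p_inner abs_mult flip: right_diff_distrib)
    also have "\<dots> \<le> norm (p k - p k') * norm e" by (rule Cauchy_Schwarz_ineq2)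
    also have "\<dots> = dist (p k) (p k')" using on[of e e] e(1) by (simp add: dist_norm norm_eq_1)
    finally have "2 * s \<le> dist (p k) (p k')" .
    then show "ball (p k) s \<inter> ball (p k') s = {}"
      using dist_triangle_half_l[of "p k" _ "2 * s" "p k'"] by (auto simp: dist_commute) 
  qed
  define S where "S = (\<Union>k\<in>I. ball (p k) s)"
  have S: "S \<in> sets borel" unfolding S_def by (intro borel_open open_UN) auto
  have "emeasure lborel S = (\<Sum>k\<in>I. emeasure lborel (ball (p k) s))"
    unfolding S_def using finI disj by (intro sum_emeasure[symmetric]) auto
  also have "\<dots> = ennreal (real L ^ (CARD('m) + 1) * (unit_ball_vol (CARD('n) + CARD('m)) * s ^ (CARD('n) + CARD('m))))"
    using s by (simp add: emeasure_ball cardI ennreal_mult ennreal_of_nat_eq_real_of_nat add.commute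
        unit_ball_vol_nonneg flip: ennreal_power)
  finally have "emeasure lborel S > 1" using large by (simp add: ennreal_less_iff flip: ennreal_1)
  define G where "G = scaled_forms (transpose \<Theta>) \<theta>"
  have G: "G = (\<lambda>(x, y). (\<theta> ^ CARD('n) *\<^sub>R x, (1 / \<theta> ^ CARD('m)) *\<^sub>R (y - transpose \<Theta> *v x)))"
    by (simp add: G_def scaled_forms_def)
  have "emeasure lborel (G -` S) = emeasure lborel S"
    unfolding G using \<theta> S
    by (intro emeasure_scaled_shear_vimage matrix_vector_mul_linear)
       (simp_all add: field_simps flip: power_mult)
  moreover have "G -` S \<in> sets borel"
  proof -
    have "open (G -` S)" unfolding S_def
      by (intro open_vimage open_UN ballI open_ball linear_continuous_on)
        (use linear_scaled_forms in \<open>auto simp: G_def linear_conv_bounded_linear\<close>)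
    then show ?thesis by simp
  qed
  ultimately have "\<exists>Y1\<in>G -` S. \<exists>Y2\<in>G -` S. Y1 \<noteq> Y2 \<and> integer_vector (Y1 - Y2)"
    using \<open>emeasure lborel S > 1\<close> by (intro blichfeldt) simp_all
  then obtain Y1 Y2 where Y: "G Y1 \<in> S" "G Y2 \<in> S" "Y1 \<noteq> Y2" "integer_vector (Y1 - Y2)"
    by blast
  obtain k1 k2 where k: "k1 \<in> I" "k2 \<in> I" "dist (p k1) (G Y1) < s" "dist (p k2) (G Y2) < s"
    using Y by (auto simp: S_def)
  define Z where "Z = G (Y1 - Y2)"
  have Z: "Z = G Y1 - G Y2" unfolding Z_def G_def by (simp add: linear_diff[OF linear_scaled_forms])
  have "norm (Z - (p k1 - p k2)) = norm ((G Y1 - p k1) - (G Y2 - p k2))" by (simp add: Z algebra_simps)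
  also have "\<dots> \<le> norm (G Y1 - p k1) + norm (G Y2 - p k2)" by (rule norm_triangle_ineq4)
  also have "\<dots> \<le> 2 * s" using k(3,4) by (simp add: dist_norm norm_minus_commute)
  finally have close: "norm (Z - (p k1 - p k2)) \<le> 2 * s" .
  have "norm (p k1 - p k2) \<le> (\<Sum>e\<in>E. 2 * s * real L)"
  proof -
    have "p k1 - p k2 = (\<Sum>e\<in>E. (2 * s * (real (k1 e) - real (k2 e))) *\<^sub>R e)"
      by (simp add: p_def right_diff_distrib scaleR_left_diff_distrib sum_subtractf)
    also have "norm \<dots> \<le> (\<Sum>e\<in>E. 2 * s * real L)"
    proof (intro sum_norm_le)
      fix e assume e: "e \<in> E"
      then have "k1 e < L" "k2 e < L" using k(1,2) by (auto simp: I_def)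
      then have "\<bar>real (k1 e) - real (k2 e)\<bar> \<le> real L" by linarith
      then show "norm ((2 * s * (real (k1 e) - real (k2 e))) *\<^sub>R e) \<le> 2 * s * real L"
        using s norm_eq_1[of e] on[OF e e] by (simp add: abs_mult)
    qed
    finally show ?thesis .
  qed
  also have "\<dots> = 2 * s * (real L * (CARD('m) + 1))" using E(2) by simp
  finally have "norm (p k1 - p k2) \<le> 2 * s * (real L * (CARD('m) + 1))" .
  moreover have "norm Z \<le> norm (Z - (p k1 - p k2)) + norm (p k1 - p k2)"
    using norm_triangle_sub[of Z "p k1 - p k2"] by linarith
  ultimately have nZ: "norm Z \<le> 2 * s * (real L * (CARD('m) + 1) + 1)"
    using close by (simp add: algebra_simps)
  have orth: "Z \<bullet> v = 0" if v: "v \<in> F ` A" for v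
  proof -
    obtain X where X: "X \<in> A" "v = F X" using v by blast
    have "Z \<bullet> v = (Y1 - Y2) \<bullet> symplectic_flip X"
      unfolding X(2) Z_def G_def F_def by (rule scaled_forms_pairing[OF \<theta>])
    then have "Z \<bullet> v \<in> \<int>" using integer_vector_pairing[OF _ Y(4)] X(1) by (simp add: A_def)
    moreover have "\<bar>Z \<bullet> v\<bar> < 1"
    proof -
      have "\<bar>Z \<bullet> v\<bar> \<le> norm Z * norm v" by (rule Cauchy_Schwarz_ineq2)
      also have "\<dots> \<le> 2 * s * (real L * (CARD('m) + 1) + 1) * r"
        using nZ X s \<open>r \<ge> 0\<close> by (intro mult_mono) (auto simp: F_def A_def)
      finally show ?thesis using small by linarith
    qed
    ultimately show ?thesis using Ints_nonzero_abs_less1 by blast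
  qed
  have "Z \<bullet> v = 0" if "v \<in> span (F ` A)" for v
    using that orth by (induction rule: span_induct_alt) (auto simp: inner_add_right)
  moreover have "p k \<in> span (F ` A)" for k
    unfolding p_def using E(1) B(1) by (intro span_sum span_scale) auto
  ultimately have "Z \<bullet> (p k1 - p k2) = 0" by (simp add: inner_diff_right)
  \<comment> \<open>The grid points lie in the span, to which \<open>Z\<close> is orthogonal. This
    improves the bound for \<open>Z\<close> from the size of the whole grid to 2 s.\<close>
  then have "norm Z * norm Z = Z \<bullet> (Z - (p k1 - p k2))"
    by (simp add: inner_diff_right dot_square_norm power2_eq_square)
  also have "\<dots> \<le> norm Z * norm (Z - (p k1 - p k2))" by (rule norm_cauchy_schwarz)
  also have "\<dots> \<le> norm Z * (2 * s)" using close by (intro mult_left_mono) auto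
  finally have "norm Z \<le> 2 * s" using s by (cases "Z = 0") auto
  then show ?thesis using Y by (intro exI[of _ "Y1 - Y2"]) (simp add: Z_def G_def)
qed

text \<open>A dual vector of length at most 2 s < \<delta>^m would contradict the spacing of the
  transpose. With \<open>s\<close> of order \<delta>^m the pairings stay below 1 for
  \<open>L\<close> up to order \<delta>^(-d), and then the volume, of order L^(m+1) s^d, is of order
  \<delta>^(-d) and exceeds 1 for small \<delta>.\<close>

lemma dim_short_vectors_le:
  assumes "K > 0"
  shows "\<exists>\<delta>\<^sub>0>0. \<forall>\<delta> \<theta>. \<forall>\<Theta> :: real^'n^'m. 0 < \<delta> \<longrightarrow> \<delta> \<le> \<delta>\<^sub>0 \<longrightarrow> \<theta> > 0 \<longrightarrow>
    well_spaced (transpose \<Theta>) \<theta> \<delta> \<longrightarrow>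
    dim {X. integer_vector X \<and> norm (scaled_forms \<Theta> \<theta> X) \<le> K * \<delta> ^ CARD('n)} \<le> CARD('m)"
proof -
  define m n where "m = CARD('m)" and "n = CARD('n)"
  define d where "d = n + m"
  have d: "d > 0" by (simp add: d_def m_def)
  define E where "E = 2 * K * (m + 2)"
  have E: "E > 0" using assms by (simp add: E_def)
  \<comment> \<open>Chosen so that the packed volume is at least \<open>G / \<delta> ^ d\<close>:
    the 3 comes from \<open>s\<close>, the 2 from rounding \<open>t\<close> down, and
    \<open>E\<close> from \<open>t\<close>.\<close>
  define G where "G = unit_ball_vol d / (3 ^ d * (2 * E) ^ (m + 1))"
  have "unit_ball_vol d > 0" by (simp add: unit_ball_vol_pos)
  then have G: "G > 0" using E by (simp add: G_def)
  define \<delta>\<^sub>0 where "\<delta>\<^sub>0 = min 1 (min (G / 2) (1 / E))"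
  have "dim {X. integer_vector X \<and> norm (scaled_forms \<Theta> \<theta> X) \<le> K * \<delta> ^ CARD('n)} \<le> CARD('m)"
    if \<delta>: "0 < \<delta>" "\<delta> \<le> \<delta>\<^sub>0" and \<theta>: "\<theta> > 0" and ws: "well_spaced (transpose \<Theta>) \<theta> \<delta>"
    for \<delta> \<theta> and \<Theta> :: "real^'n^'m"
  proof (rule ccontr)
    assume neg: "\<not> ?thesis"
    have "\<delta> ^ d \<le> \<delta> ^ 1" using \<delta> d by (intro power_decreasing) (auto simp: \<delta>\<^sub>0_def)
    then have \<delta>d: "\<delta> ^ d < G" "\<delta> ^ d \<le> 1 / E" using \<delta> G by (auto simp: \<delta>\<^sub>0_def)
    define t where "t = 1 / (E * \<delta> ^ d)"
    have t: "t \<ge> 1" using \<delta>d(2) \<delta>(1) E by (simp add: t_def field_simps)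
    define L where "L = nat \<lfloor>t\<rfloor>"
    have "real L = of_int \<lfloor>t\<rfloor>" "\<lfloor>t\<rfloor> \<ge> 1" using t by (auto simp: L_def)
    then have L: "real L \<le> t" "real L \<ge> t / 2" "real L \<ge> 1" by linarith+
    define s where "s = \<delta> ^ m / 3"
    have s: "s > 0" using \<delta>(1) by (simp add: s_def)
    have "\<exists>Y. integer_vector Y \<and> Y \<noteq> 0 \<and> norm (scaled_forms (transpose \<Theta>) \<theta> Y) \<le> 2 * s"
    proof (rule short_dual_vector[OF \<theta> s])
      show "K * \<delta> ^ CARD('n) \<ge> 0" using assms \<delta>(1) by simp
      have "real L * (m + 1) + 1 \<le> t * (m + 2)" using L(1,3) t by (simp add: algebra_simps; smt (verit) mult_right_mono of_nat_0_le_iff)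
      then have "2 * s * (real L * (m + 1) + 1) * (K * \<delta> ^ n) \<le> 2 * s * (t * (m + 2)) * (K * \<delta> ^ n)"
        using s assms \<delta>(1) by (intro mult_right_mono mult_left_mono) auto
      also have "\<dots> = 2 / 3 * K * (m + 2) * (\<delta> ^ d) * t" by (simp add: s_def d_def power_add)
      also have "\<dots> = (E * \<delta> ^ d * t) / 3" by (simp add: E_def)
      also have "\<dots> = 1 / 3" using \<delta>(1) E by (simp add: t_def)
      finally show "2 * s * (real L * (CARD('m) + 1) + 1) * (K * \<delta> ^ CARD('n)) < 1"
        by (simp add: m_def n_def)
      have "1 < G / \<delta> ^ d" using \<delta>d(1) \<delta>(1) by simp
      also have "\<dots> = (t / 2) ^ (m + 1) * (unit_ball_vol d * s ^ d)"
      proof -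
        have "(\<delta> ^ d) ^ (m + 1) = \<delta> ^ d * (\<delta> ^ m) ^ d" by (simp add: mult.commute flip: power_mult power_add)
        then show ?thesis using \<delta>(1) E
          by (simp add: G_def t_def s_def power_divide power_mult_distrib field_simps)
      qed
      also have "\<dots> \<le> real L ^ (m + 1) * (unit_ball_vol d * s ^ d)"
        using L(2) t s by (intro mult_right_mono power_mono mult_nonneg_nonneg) auto
      finally show "1 < real L ^ (CARD('m) + 1) * (unit_ball_vol (CARD('n) + CARD('m)) * s ^ (CARD('n) + CARD('m)))"
        by (simp add: m_def n_def d_def)
    qed (use neg in simp)
    then obtain Y where "integer_vector Y" "Y \<noteq> 0" "norm (scaled_forms (transpose \<Theta>) \<theta> Y) \<le> 2 * s" by blast
    moreover have "\<delta> ^ m \<le> norm (scaled_forms (transpose \<Theta>) \<theta> Y)"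
      using ws calculation(1,2) unfolding well_spaced_def m_def by blast
    ultimately have "\<delta> ^ m \<le> 2 * s" by linarith
    then show False using \<delta>(1) by (simp add: s_def)
  qed
  moreover have "\<delta>\<^sub>0 > 0" using G E by (simp add: \<delta>\<^sub>0_def)
  ultimately show ?thesis by blast
qed

subsection \<open>Well spaced systems of linear forms\<close>

lemma norm_matrix_vector_mult_le:
  fixes A :: "real^'n^'m"
  shows "norm (A *v x) \<le> norm A * norm x"
proof -
  have "(A *v x) $ j = A $ j \<bullet> x" for j by (simp add: matrix_vector_mult_def inner_vec_def)
  then have "norm (A *v x) = L2_set (\<lambda>j. \<bar>A $ j \<bullet> x\<bar>) UNIV"
    by (simp add: norm_vec_def[of "A *v x"])
  also have "\<dots> \<le> L2_set (\<lambda>j. norm (A $ j) * norm x) UNIV"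
    by (intro L2_set_mono) (auto simp: Cauchy_Schwarz_ineq2)
  also have "\<dots> = norm A * norm x" by (simp add: norm_vec_def[of A] L2_set_left_distrib)
  finally show ?thesis .
qed

lemma norm_transpose: "norm (transpose A) = norm (A :: real^'n^'m)"
proof -
  have "transpose A \<bullet> transpose A = A \<bullet> A"
    by (simp add: inner_vec_def transpose_def) (rule sum.swap)
  then show ?thesis by (simp add: norm_eq_sqrt_inner)
qed

lemma dist_transpose: "dist (transpose A) (transpose B) = dist A (B :: real^'n^'m)"
proof -
  have "transpose A - transpose B = transpose (A - B)" by (simp add: transpose_def vec_eq_iff)
  then show ?thesis by (simp add: dist_norm norm_transpose)
qed

text \<open>Moving the centre changes the second component by at most r |x|. The right-hand norm
  controls t r |x|, which costs the factor 1 / t; the 3 counts r |x| twice and the second component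
  once.\<close>

lemma norm_recenter:
  fixes c c' :: "real^'n^'m"
  assumes "dist c c' \<le> r" "0 < t" "t \<le> 1"
  shows "norm (r *\<^sub>R x, y - c *v x) \<le> 3 / t * norm ((t * r) *\<^sub>R x, y - c' *v x)"
proof -
  let ?R = "norm ((t * r) *\<^sub>R x, y - c' *v x)"
  have r: "r \<ge> 0" using assms(1) zero_le_dist[of c c'] by linarith
  have 1: "t * (r * norm x) \<le> ?R"
    using norm_fst_le[of "(t * r) *\<^sub>R x" "y - c' *v x"] assms r by (simp add: abs_mult mult.assoc)
  have 2: "norm (y - c' *v x) \<le> ?R"
    using norm_snd_le[of "y - c' *v x" "(t * r) *\<^sub>R x"] by simp
  have "y - c *v x = (y - c' *v x) - (c - c') *v x" by (simp add: matrix_vector_mult_diff_rdistrib)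
  then have "norm (y - c *v x) \<le> norm (y - c' *v x) + norm ((c - c') *v x)"
    by (metis norm_triangle_ineq4)
  also have "norm ((c - c') *v x) \<le> norm (c - c') * norm x" by (rule norm_matrix_vector_mult_le)
  also have "\<dots> \<le> r * norm x" using assms(1) by (intro mult_right_mono) (auto simp: dist_norm)
  finally have 3: "norm (y - c *v x) \<le> ?R + r * norm x" using 2 by linarith
  have "norm (r *\<^sub>R x, y - c *v x) \<le> norm (r *\<^sub>R x) + norm (y - c *v x)" by (rule norm_Pair_le)
  then have "norm (r *\<^sub>R x, y - c *v x) \<le> ?R + 2 * (r * norm x)" using 3 r by simp
  then have "t * norm (r *\<^sub>R x, y - c *v x) \<le> t * (?R + 2 * (r * norm x))"
    using assms(2) by (intro mult_left_mono) auto
  also have "\<dots> = t * ?R + 2 * (t * (r * norm x))" by (simp add: algebra_simps)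
  also have "\<dots> \<le> 1 * ?R + 2 * ?R" using 1 assms(3) by (intro add_mono mult_right_mono) auto
  finally show ?thesis using assms(2) by (simp add: field_simps)
qed

text \<open>Expresses the renormalised length through the ball radius \<theta>^(n+m), the form in
  which transversality is forced.\<close>

lemma norm_scaled_forms:
  fixes \<Theta> :: "real^'n^'m"
  assumes "\<theta> > 0"
  shows "norm (scaled_forms \<Theta> \<theta> (x, y)) =
    norm (\<theta> ^ (CARD('n) + CARD('m)) *\<^sub>R x, y - \<Theta> *v x) / \<theta> ^ CARD('n)"
proof -
  have "scaled_forms \<Theta> \<theta> (x, y) = (1 / \<theta> ^ CARD('n)) *\<^sub>R (\<theta> ^ (CARD('n) + CARD('m)) *\<^sub>R x, y - \<Theta> *v x)"
    using assms by (simp add: scaled_forms_def power_add)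
  then show ?thesis using assms by (simp only: norm_scaleR) simp
qed

text \<open>Only vectors in the span of the short ones can become too short, and along that span the second
  component already has the right size and is expanded by \<open>1 / p ^ n\<close>.\<close>

lemma well_spaced_step:
  fixes \<Theta> \<Theta>' :: "real^'n^'m"
  defines "d \<equiv> CARD('n) + CARD('m)"
  assumes pos: "0 < \<theta>" "0 < p" "p \<le> 1" "p \<le> \<kappa>" "0 < \<delta>"
    and ws: "well_spaced \<Theta> \<theta> \<delta>" and dist: "dist \<Theta> \<Theta>' \<le> \<theta> ^ d"
    and trans: "\<And>x y. (x, y) \<in> span {X. integer_vector X \<and>
        norm (scaled_forms \<Theta> \<theta> X) \<le> 3 / p ^ d * \<delta> ^ CARD('n)} \<Longrightarrow>
      norm (y - \<Theta>' *v x) \<ge> \<kappa> * norm (\<theta> ^ d *\<^sub>R x, y - \<Theta> *v x)"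
  shows "well_spaced \<Theta>' (p * \<theta>) \<delta>"
  unfolding well_spaced_def
proof (intro allI impI, rule ccontr)
  let ?n = "CARD('n)"
  fix X :: "(real^'n) \<times> (real^'m)"
  assume X: "integer_vector X" "X \<noteq> 0" and neg: "\<not> \<delta> ^ ?n \<le> norm (scaled_forms \<Theta>' (p * \<theta>) X)"
  obtain x y where xy: "X = (x, y)" by (cases X)
  have p\<theta>: "p * \<theta> > 0" using pos by simp
  let ?a = "norm (\<theta> ^ d *\<^sub>R x, y - \<Theta> *v x)" and ?b = "norm ((p * \<theta>) ^ d *\<^sub>R x, y - \<Theta>' *v x)"
  have b: "?b < \<delta> ^ ?n * (p * \<theta>) ^ ?n"
    using neg p\<theta> by (simp add: xy norm_scaled_forms[OF p\<theta>] d_def not_le divide_less_eq)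
  \<comment> \<open>Together with p \<le> \<kappa> this lets the expansion by 1 / p^n outweigh the
    factor \<kappa> lost through transversality.\<close>
  have pn: "p ^ ?n \<le> p ^ 1" using pos by (intro power_decreasing) auto
  \<comment> \<open>A vector too short at the new scale was already short at the old one up to the
    factor 3 / p^d, so \<open>trans\<close> applies to it.\<close>
  have "?a \<le> 3 / p ^ d * norm ((p ^ d * \<theta> ^ d) *\<^sub>R x, y - \<Theta>' *v x)"
    using dist pos by (intro norm_recenter) (auto intro: power_le_one)
  also have "\<dots> = 3 / p ^ d * ?b" by (simp add: power_mult_distrib)
  also have "\<dots> \<le> 3 / p ^ d * (\<delta> ^ ?n * (p * \<theta>) ^ ?n)"
    using b pos by (intro mult_left_mono) auto
  also have "\<dots> \<le> 3 / p ^ d * (\<delta> ^ ?n * (1 * \<theta>) ^ ?n)"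
    using pos by (intro mult_left_mono power_mono mult_right_mono) auto
  finally have "?a \<le> 3 / p ^ d * \<delta> ^ ?n * \<theta> ^ ?n" by simp
  then have "norm (scaled_forms \<Theta> \<theta> X) \<le> 3 / p ^ d * \<delta> ^ ?n"
    using pos by (simp add: xy norm_scaled_forms d_def divide_le_eq)
  then have "(x, y) \<in> span {X. integer_vector X \<and> norm (scaled_forms \<Theta> \<theta> X) \<le> 3 / p ^ d * \<delta> ^ ?n}"
    using X xy by (intro span_base) simp
  from trans[OF this] have 1: "\<kappa> * ?a \<le> norm (y - \<Theta>' *v x)" .
  have "\<delta> ^ ?n \<le> norm (scaled_forms \<Theta> \<theta> X)" using ws X unfolding well_spaced_def by blast
  then have "\<delta> ^ ?n * \<theta> ^ ?n \<le> ?a" using pos by (simp add: xy norm_scaled_forms d_def le_divide_eq)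
  then have "p * (\<delta> ^ ?n * \<theta> ^ ?n) \<le> \<kappa> * ?a" using pos by (intro mult_mono) auto
  moreover have "p ^ ?n * (\<delta> ^ ?n * \<theta> ^ ?n) \<le> p * (\<delta> ^ ?n * \<theta> ^ ?n)"
    using pn pos by (intro mult_right_mono) auto
  moreover have "norm (y - \<Theta>' *v x) \<le> ?b" using norm_snd_le[of "y - \<Theta>' *v x" "(p * \<theta>) ^ d *\<^sub>R x"] by simp
  ultimately have "p ^ ?n * (\<delta> ^ ?n * \<theta> ^ ?n) \<le> ?b" using 1 by linarith
  then show False using b by (simp add: power_mult_distrib ac_simps)
qed

lemma integer_vector_norm_ge_1:
  fixes x :: "'a::euclidean_space"
  assumes "integer_vector x" "x \<noteq> 0"
  shows "norm x \<ge> 1"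
proof -
  obtain b where b: "b \<in> Basis" "x \<bullet> b \<noteq> 0" using assms(2) by (metis euclidean_all_zero_iff)
  then have "\<bar>x \<bullet> b\<bar> \<ge> 1" using assms(1) by (meson Ints_nonzero_abs_ge1 integer_vector_def)
  then show ?thesis using Basis_le_norm[OF b(1), of x] by linarith
qed

text \<open>A nonzero integer vector has |x| \<ge> 1, or x = 0 and |y| \<ge> 1. Validity for all
  small \<delta> allows several constraints on \<delta> to be met at once at the start of the
  game.\<close>

lemma well_spaced_exists:
  fixes \<Theta> :: "real^'n^'m"
  assumes "\<theta> > 0"
  shows "\<exists>\<delta>\<^sub>1>0. \<forall>\<delta>. 0 < \<delta> \<longrightarrow> \<delta> \<le> \<delta>\<^sub>1 \<longrightarrow> well_spaced \<Theta> \<theta> \<delta>"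
proof (intro exI[of _ "min 1 (min (\<theta> ^ CARD('m)) (1 / \<theta> ^ CARD('n)))"] conjI allI impI)
  fix \<delta> assume \<delta>: "0 < \<delta>" "\<delta> \<le> min 1 (min (\<theta> ^ CARD('m)) (1 / \<theta> ^ CARD('n)))"
  have "\<delta> ^ CARD('n) \<le> \<delta> ^ 1" using \<delta> by (intro power_decreasing) (auto simp: Suc_le_eq)
  then have \<delta>n: "\<delta> ^ CARD('n) \<le> \<theta> ^ CARD('m)" "\<delta> ^ CARD('n) \<le> 1 / \<theta> ^ CARD('n)" using \<delta> by auto
  show "well_spaced \<Theta> \<theta> \<delta>"
    unfolding well_spaced_def
  proof (intro allI impI)
    fix X :: "(real^'n) \<times> (real^'m)"
    assume X: "integer_vector X" "X \<noteq> 0"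
    obtain x y where xy: "X = (x, y)" by (cases X)
    have int: "integer_vector x" "integer_vector y" using X by (simp_all add: xy integer_vector_Pair_iff)
    show "\<delta> ^ CARD('n) \<le> norm (scaled_forms \<Theta> \<theta> X)"
    proof (cases "x = 0")
      case True
      then have "norm y \<ge> 1" using X int integer_vector_norm_ge_1[of y] by (auto simp: xy zero_prod_def)
      then have "1 / \<theta> ^ CARD('n) \<le> norm (scaled_forms \<Theta> \<theta> X)"
        using True assms by (simp add: xy scaled_forms_def norm_Pair divide_right_mono)
      then show ?thesis using \<delta>n(2) by linarith
    next
      case False
      then have "norm x \<ge> 1" using int integer_vector_norm_ge_1 by blast
      then have "\<theta> ^ CARD('m) * 1 \<le> \<theta> ^ CARD('m) * norm x" using assms by (intro mult_left_mono) auto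
      also have "\<dots> \<le> norm (scaled_forms \<Theta> \<theta> X)"
        using norm_fst_le[of "\<theta> ^ CARD('m) *\<^sub>R x" "(1 / \<theta> ^ CARD('n)) *\<^sub>R (y - \<Theta> *v x)"] assms
        by (simp add: xy scaled_forms_def)
      finally show ?thesis using \<delta>n(1) by linarith
    qed
  qed
qed (use assms in auto)

text \<open>One direction of Dani's correspondence. For each integral x take the first scale at
  which the first component is short: there the second component must be long, and minimality keeps
  the first from being much too short.\<close>

lemma badly_approximable_if_well_spaced:
  fixes \<Theta> :: "real^'n^'m"
  assumes p: "0 < p" "p < 1" and \<theta>: "0 < \<theta>" and \<delta>: "0 < \<delta>"
    and ws: "\<And>k. \<exists>c. dist c \<Theta> \<le> (p ^ k * \<theta>) ^ (CARD('n) + CARD('m)) \<and> well_spaced c (p ^ k * \<theta>) \<delta>"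
  shows "badly_approximable \<Theta>"
proof -
  define m n where "m = CARD('m)" and "n = CARD('n)"
  have mn: "m > 0" "n > 0" by (simp_all add: m_def n_def)
  \<comment> \<open>The 6 combines the factor 3 of \<open>norm_recenter\<close> with a factor 2, the
    first component being allowed at most half of the total.\<close>
  define \<epsilon> where "\<epsilon> = \<delta> ^ n / 6"
  have \<epsilon>: "\<epsilon> > 0" using \<delta> by (simp add: \<epsilon>_def)
  define t where "t k = p ^ k * \<theta>" for k
  have t: "t k > 0" for k using p \<theta> by (simp add: t_def)
  have lower: "\<epsilon> * t k ^ n \<le> norm (y - \<Theta> *v x)"
    if X: "integer_vector (x, y)" "x \<noteq> 0" and small: "t k ^ m * norm x \<le> \<epsilon>" for x y k
  proof -
    obtain c where c: "dist c \<Theta> \<le> t k ^ (n + m)" "well_spaced c (t k) \<delta>"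
      using ws[of k] by (auto simp: t_def n_def m_def)
    have "(x, y) \<noteq> 0" using X(2) by (simp add: zero_prod_def)
    then have "\<delta> ^ n \<le> norm (scaled_forms c (t k) (x, y))"
      using c(2) X(1) by (auto simp: well_spaced_def n_def)
    then have "\<delta> ^ n * t k ^ n \<le> norm (t k ^ (n + m) *\<^sub>R x, y - c *v x)"
      using t[of k] by (simp add: norm_scaled_forms n_def m_def le_divide_eq)
    also have "\<dots> \<le> 3 / 1 * norm ((1 * t k ^ (n + m)) *\<^sub>R x, y - \<Theta> *v x)"
      using c(1) by (intro norm_recenter) auto
    also have "norm ((1 * t k ^ (n + m)) *\<^sub>R x, y - \<Theta> *v x) \<le> norm ((1 * t k ^ (n + m)) *\<^sub>R x) + norm (y - \<Theta> *v x)"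
      by (rule norm_Pair_le)
    also have "norm ((1 * t k ^ (n + m)) *\<^sub>R x) = t k ^ n * (t k ^ m * norm x)"
      using t[of k] by (simp add: power_add)
    also have "t k ^ n * (t k ^ m * norm x) \<le> t k ^ n * \<epsilon>" using small t[of k] by (intro mult_left_mono) auto
    finally have "6 * \<epsilon> * t k ^ n \<le> 3 / 1 * (t k ^ n * \<epsilon> + norm (y - \<Theta> *v x))" by (simp add: \<epsilon>_def)
    then show ?thesis by (simp add: algebra_simps)
  qed
  \<comment> \<open>A lower bound for \<open>t k ^ m * norm x\<close> at the least admissible
    \<open>k\<close>: the first entry covers \<open>k = 0\<close>, the second a predecessor scale
    that still exceeds \<open>\<epsilon>\<close>.\<close>
  define g where "g = min (\<theta> ^ m) (p ^ m * \<epsilon>)"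
  have g: "g > 0" using \<theta> p \<epsilon> by (simp add: g_def)
  have prod_bound: "\<epsilon> ^ m * g ^ n \<le> norm x ^ n * norm (y - \<Theta> *v x) ^ m"
    if X: "integer_vector (x, y)" "x \<noteq> 0" for x y
  proof -
    have nx: "norm x \<ge> 1" using X integer_vector_norm_ge_1 by (auto simp: integer_vector_Pair_iff)
    have pm: "p ^ m < 1" using p mn by (simp add: power_less_one_iff)
    have tk: "t k ^ m * norm x = (p ^ m) ^ k * (\<theta> ^ m * norm x)" for k
      by (simp add: t_def power_mult_distrib mult.commute flip: power_mult)
    have "\<exists>k. t k ^ m * norm x \<le> \<epsilon>"
    proof -
      have "\<theta> ^ m * norm x > 0" using \<theta> nx by (intro mult_pos_pos) auto
      moreover obtain k where "(p ^ m) ^ k < \<epsilon> / (\<theta> ^ m * norm x)"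
        using real_arch_pow_inv[OF _ pm, of "\<epsilon> / (\<theta> ^ m * norm x)"] \<epsilon> calculation by auto
      ultimately have "t k ^ m * norm x < \<epsilon>" unfolding tk by (simp add: pos_less_divide_eq)
      then show ?thesis by (intro exI[of _ k]) simp
    qed
    define k where "k = (LEAST k. t k ^ m * norm x \<le> \<epsilon>)"
    have k: "t k ^ m * norm x \<le> \<epsilon>" unfolding k_def by (rule LeastI_ex) fact
    have gk: "g \<le> t k ^ m * norm x"
    proof (cases k)
      case 0
      have "\<theta> ^ m * 1 \<le> \<theta> ^ m * norm x" using nx \<theta> by (intro mult_left_mono) auto
      then show ?thesis using 0 by (simp add: g_def t_def)
    next
      case (Suc j)
      then have "\<not> t j ^ m * norm x \<le> \<epsilon>" using not_less_Least[of j "\<lambda>k. t k ^ m * norm x \<le> \<epsilon>"] by (simp add: k_def)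
      then have "p ^ m * \<epsilon> \<le> p ^ m * (t j ^ m * norm x)" using p by (intro mult_left_mono) auto
      also have "\<dots> = t k ^ m * norm x" unfolding tk Suc by simp
      finally show ?thesis by (simp add: g_def)
    qed
    have "\<epsilon> ^ m * g ^ n \<le> \<epsilon> ^ m * (t k ^ m * norm x) ^ n"
      using gk g \<epsilon> by (intro mult_left_mono power_mono) auto
    also have "\<dots> = norm x ^ n * (\<epsilon> * t k ^ n) ^ m"
      by (simp add: power_mult_distrib mult.commute flip: power_mult)
    also have "\<dots> \<le> norm x ^ n * norm (y - \<Theta> *v x) ^ m"
      using lower[OF X k] \<epsilon> t[of k] by (intro mult_left_mono power_mono) auto
    finally show ?thesis .
  qed
  \<comment> \<open>Passing from Euclidean to maximum norms costs a factor n in one variable and m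
    in the other; halving \<open>C\<close> below yields the strict inequality.\<close>
  define C where "C = \<epsilon> ^ m * g ^ n / (real n ^ n * real m ^ m)"
  have C: "C > 0" using \<epsilon> g mn by (simp add: C_def)
  show ?thesis
    unfolding badly_approximable_def
  proof (intro exI[of _ "C / 2"] conjI allI impI)
    show "C / 2 > 0" using C by simp
  next
    fix x :: "int^'n" assume x: "x \<noteq> 0"
    define X where "X = (\<chi> i. real_of_int (x $ i))"
    define Y where "Y = (\<chi> j. real_of_int (round (lin_form \<Theta> j x)))"
    have lf: "lin_form \<Theta> j x = (\<Theta> *v X) $ j" for j
      by (simp add: lin_form_def X_def matrix_vector_mult_def)
    have int: "integer_vector (X, Y)"
      unfolding integer_vector_Pair_iff
      by (auto simp: integer_vector_def X_def Y_def Basis_vec_def inner_axis)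
    have X0: "X \<noteq> 0" using x by (auto simp: X_def vec_eq_iff)
    define H where "H = (MAX i\<in>UNIV. \<bar>real_of_int (x $ i)\<bar>)"
    define D where "D = (MAX j\<in>UNIV. dist_nearest_int (lin_form \<Theta> j x))"
    have H: "\<bar>X $ i\<bar> \<le> H" for i unfolding H_def X_def by (intro Max_ge) auto
    have D: "\<bar>(Y - \<Theta> *v X) $ j\<bar> \<le> D" for j
    proof -
      have "\<bar>(Y - \<Theta> *v X) $ j\<bar> = dist_nearest_int (lin_form \<Theta> j x)"
        by (simp add: Y_def lf dist_nearest_int_def abs_minus_commute)
      then show ?thesis unfolding D_def by (simp add: Max_ge)
    qed
    have "norm X \<le> (\<Sum>i\<in>UNIV. \<bar>X $ i\<bar>)" by (rule norm_le_l1_cart)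
    also have "\<dots> \<le> real n * H" using sum_bounded_above[of UNIV "\<lambda>i. \<bar>X $ i\<bar>" H] H by (simp add: n_def)
    finally have nX: "norm X \<le> real n * H" .
    have "norm (Y - \<Theta> *v X) \<le> (\<Sum>j\<in>UNIV. \<bar>(Y - \<Theta> *v X) $ j\<bar>)" by (rule norm_le_l1_cart)
    also have "\<dots> \<le> real m * D"
      using sum_bounded_above[of UNIV "\<lambda>j. \<bar>(Y - \<Theta> *v X) $ j\<bar>" D] D by (simp add: m_def)
    finally have nY: "norm (Y - \<Theta> *v X) \<le> real m * D" .
    have "\<epsilon> ^ m * g ^ n \<le> norm X ^ n * norm (Y - \<Theta> *v X) ^ m" by (rule prod_bound[OF int X0])
    also have "\<dots> \<le> (real n * H) ^ n * (real m * D) ^ m"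
      using nX nY order_trans[OF norm_ge_zero nX] by (intro mult_mono power_mono zero_le_power) auto
    also have "\<dots> = (real n ^ n * real m ^ m) * (H ^ n * D ^ m)" by (simp add: power_mult_distrib)
    finally have "C \<le> H ^ n * D ^ m" using mn by (simp add: C_def divide_le_eq mult.commute)
    then show "C / 2 < (MAX i\<in>UNIV. \<bar>real_of_int (x $ i)\<bar>) ^ CARD('n) *
      (MAX j\<in>UNIV. dist_nearest_int (lin_form \<Theta> j x)) ^ CARD('m)"
      using C by (simp add: H_def D_def n_def m_def)
  qed
qed

section \<open>Rational subspaces\<close>

lemma rational_subspace_imp_subspace: "rational_subspace M \<Longrightarrow> subspace M"
  by (auto simp: rational_subspace_def)

text \<open>The graph has dimension n, so the rational subspaces concerned have dimension (n + m) -
  n = m.\<close>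

lemma completely_irrational_graph:
  fixes \<Theta> :: "real^'n^'m"
  assumes "\<And>M x y. rational_subspace M \<Longrightarrow> dim M \<le> CARD('m) \<Longrightarrow> (x, y) \<in> M \<Longrightarrow> y = \<Theta> *v x \<Longrightarrow> x = 0 \<and> y = 0"
  shows "completely_irrational {(x :: real^'n, y :: real^'m). y = \<Theta> *v x}"
proof -
  let ?L = "{(x :: real^'n, y :: real^'m). y = \<Theta> *v x}"
  have lin: "linear (\<lambda>x. (x, \<Theta> *v x))"
    by (rule linearI) (auto simp: matrix_vector_right_distrib matrix_vector_mult_scaleR)
  have L: "?L = range (\<lambda>x. (x, \<Theta> *v x))" by auto
  have sub: "subspace ?L" unfolding L by (rule linear_subspace_image[OF lin subspace_UNIV])
  have "dim ?L = CARD('n)"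
    unfolding L using dim_image_eq[OF lin, of UNIV] by (simp add: inj_on_def)
  moreover have "?L \<inter> M = {0}" if M: "rational_subspace M" "dim M \<le> CARD('m)" for M
  proof -
    have "subspace M" using M(1) by (rule rational_subspace_imp_subspace)
    then have "0 \<in> ?L \<inter> M" using subspace_0[OF sub] subspace_0 by blast
    moreover have "?L \<inter> M \<subseteq> {0}"
      using assms[OF M] by (auto simp: zero_prod_def)
    ultimately show ?thesis by (simp add: subset_antisym)
  qed
  ultimately show ?thesis unfolding completely_irrational_def using sub by simp
qed

lemma countable_rational_subspaces: "countable {M :: 'a::euclidean_space set. rational_subspace M}"
proof -
  have "{M :: 'a set. rational_subspace M} \<subseteq> span ` {B. finite B \<and> B \<subseteq> {z. integer_vector z}}"
  proof
    fix M :: "'a set" assume "M \<in> {M. rational_subspace M}"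
    then obtain B where "independent B" "span B = M" "\<forall>v\<in>B. integer_vector v"
      by (auto simp: rational_subspace_def)
    then show "M \<in> span ` {B. finite B \<and> B \<subseteq> {z. integer_vector z}}"
      using independent_imp_finite by (intro image_eqI[of _ _ B]) auto
  qed
  moreover have "countable {B :: 'a set. finite B \<and> B \<subseteq> {z. integer_vector z}}"
    by (rule countable_Collect_finite_subset[OF countable_integer_vectors])
  ultimately show ?thesis by (rule countable_subset[OF _ countable_image])
qed

section \<open>Forcing transversality for a matrix and its transpose\<close>

context schmidt_game
begin

text \<open>Transposition is a surjective isometry, through which the game on the transposed
  matrices is transferred.\<close>

lemma forces_transversal_dual:
  "\<exists>N. \<exists>\<kappa>>0. \<forall>M c r. subspace M \<longrightarrow> dim M \<le> CARD('n) \<longrightarrow> r > 0 \<longrightarrow>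
     forces \<alpha> \<beta> N (\<lambda>c' r'. \<forall>\<Theta>\<in>cball c' r'. \<forall>(x, y)\<in>M.
       norm (y - transpose \<Theta> *v x) \<ge> \<kappa> * norm (r *\<^sub>R x, y - transpose c *v x)) (c :: real^'n^'m) r"
proof -
  obtain N \<kappa> where N: "\<kappa> > 0" "\<And>M c r. subspace M \<Longrightarrow> dim M \<le> CARD('n) \<Longrightarrow> r > 0 \<Longrightarrow>
     forces \<alpha> \<beta> N (\<lambda>c' r'. \<forall>\<Theta>\<in>cball c' r'. \<forall>(x, y)\<in>M.
       norm (y - \<Theta> *v x) \<ge> \<kappa> * norm (r *\<^sub>R x, y - c *v x)) (c :: real^'m^'n) r"
    using forces_transversal by blast
  have "forces \<alpha> \<beta> N (\<lambda>c' r'. \<forall>\<Theta>\<in>cball c' r'. \<forall>(x, y)\<in>M.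
       norm (y - transpose \<Theta> *v x) \<ge> \<kappa> * norm (r *\<^sub>R x, y - transpose c *v x)) c r"
    if M: "subspace M" "dim M \<le> CARD('n)" "r > 0" for M and c :: "real^'n^'m" and r
  proof -
    let ?Q = "\<lambda>(c' :: real^'n^'m) r'. \<forall>\<Theta>\<in>cball c' r'. \<forall>(x, y)\<in>M.
       norm (y - transpose \<Theta> *v x) \<ge> \<kappa> * norm (r *\<^sub>R x, y - transpose c *v x)"
    have "forces \<alpha> \<beta> N ?Q (transpose (transpose c)) (1 * r)"
    proof (rule forces_similarity[where S = transpose and k = 1])
      show "surj (transpose :: real^'m^'n \<Rightarrow> real^'n^'m)" by (rule surjI[of _ transpose]) simp
      show "forces \<alpha> \<beta> N (\<lambda>c r. ?Q (transpose c) (1 * r)) (transpose c) r"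
        using N(2)[OF M, of "transpose c"]
      proof (rule forces_mono, intro ballI)
        fix c' :: "real^'m^'n" and r' and \<Theta> :: "real^'n^'m" and z
        assume A: "\<forall>\<Theta>\<in>cball c' r'. \<forall>(x, y)\<in>M.
            norm (y - \<Theta> *v x) \<ge> \<kappa> * norm (r *\<^sub>R x, y - transpose c *v x)"
          and \<Theta>: "\<Theta> \<in> cball (transpose c') (1 * r')" and z: "z \<in> M"
        have "transpose \<Theta> \<in> cball c' r'" using \<Theta> dist_transpose[of c' "transpose \<Theta>"] by simp
        then show "case z of (x, y) \<Rightarrow> norm (y - transpose \<Theta> *v x) \<ge> \<kappa> * norm (r *\<^sub>R x, y - transpose c *v x)"
          using A z by blast
      qed
    qed (simp_all add: dist_transpose)
    then show ?thesis by simp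
  qed
  then show ?thesis using N(1) by blast
qed

text \<open>Three runs one after the other; earlier bounds survive because they hold on the whole
  ball reached. Of the third run, meant for a prescribed rational subspace, only the qualitative
  conclusion is kept.\<close>

lemma forces_transversal_triple:
  "\<exists>N. \<exists>\<kappa>>0. \<forall>M\<^sub>1 M\<^sub>2 M\<^sub>3 c r. subspace M\<^sub>1 \<longrightarrow> dim M\<^sub>1 \<le> CARD('m) \<longrightarrow> subspace M\<^sub>2 \<longrightarrow> dim M\<^sub>2 \<le> CARD('n) \<longrightarrow>
     subspace M\<^sub>3 \<longrightarrow> dim M\<^sub>3 \<le> CARD('m) \<longrightarrow> r > 0 \<longrightarrow>
     forces \<alpha> \<beta> N (\<lambda>c' r'. \<forall>\<Theta>\<in>cball c' r'.
       (\<forall>(x, y)\<in>M\<^sub>1. norm (y - \<Theta> *v x) \<ge> \<kappa> * norm (r *\<^sub>R x, y - c *v x)) \<and>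
       (\<forall>(x, y)\<in>M\<^sub>2. norm (y - transpose \<Theta> *v x) \<ge> \<kappa> * norm (r *\<^sub>R x, y - transpose c *v x)) \<and>
       (\<forall>(x, y)\<in>M\<^sub>3. y = \<Theta> *v x \<longrightarrow> x = 0 \<and> y = 0)) (c :: real^'n^'m) r"
proof -
  obtain N\<^sub>1 \<kappa>\<^sub>1 where N1: "\<kappa>\<^sub>1 > 0" "\<And>M c r. subspace M \<Longrightarrow> dim M \<le> CARD('m) \<Longrightarrow> r > 0 \<Longrightarrow>
     forces \<alpha> \<beta> N\<^sub>1 (\<lambda>c' r'. \<forall>\<Theta>\<in>cball c' r'. \<forall>(x, y)\<in>M.
       norm (y - \<Theta> *v x) \<ge> \<kappa>\<^sub>1 * norm (r *\<^sub>R x, y - c *v x)) (c :: real^'n^'m) r"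
    using forces_transversal by blast
  obtain N\<^sub>2 \<kappa>\<^sub>2 where N2: "\<kappa>\<^sub>2 > 0" "\<And>M c r. subspace M \<Longrightarrow> dim M \<le> CARD('n) \<Longrightarrow> r > 0 \<Longrightarrow>
     forces \<alpha> \<beta> N\<^sub>2 (\<lambda>c' r'. \<forall>\<Theta>\<in>cball c' r'. \<forall>(x, y)\<in>M.
       norm (y - transpose \<Theta> *v x) \<ge> \<kappa>\<^sub>2 * norm (r *\<^sub>R x, y - transpose c *v x)) (c :: real^'n^'m) r"
    using forces_transversal_dual by blast
  \<comment> \<open>The second run measures lengths relative to the smaller ball from which it
    starts; returning to \<open>(c, r)\<close> by \<open>norm_recenter\<close> with ratio
    \<open>q ^ N\<^sub>1\<close> costs the factor \<open>q ^ N\<^sub>1 / 3\<close>.\<close>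
  define \<kappa> where "\<kappa> = min \<kappa>\<^sub>1 (\<kappa>\<^sub>2 * q ^ N\<^sub>1 / 3)"
  have qN: "0 < q ^ N\<^sub>1" "q ^ N\<^sub>1 \<le> 1" using q_pos q_less_1 by (auto intro: power_le_one)
  have \<kappa>: "\<kappa> > 0" using N1(1) N2(1) qN by (simp add: \<kappa>_def)
  have "forces \<alpha> \<beta> (N\<^sub>1 + N\<^sub>2 + N\<^sub>1) (\<lambda>c' r'. \<forall>\<Theta>\<in>cball c' r'.
       (\<forall>(x, y)\<in>M\<^sub>1. norm (y - \<Theta> *v x) \<ge> \<kappa> * norm (r *\<^sub>R x, y - c *v x)) \<and>
       (\<forall>(x, y)\<in>M\<^sub>2. norm (y - transpose \<Theta> *v x) \<ge> \<kappa> * norm (r *\<^sub>R x, y - transpose c *v x)) \<and>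
       (\<forall>(x, y)\<in>M\<^sub>3. y = \<Theta> *v x \<longrightarrow> x = 0 \<and> y = 0)) c r"
    if M: "subspace M\<^sub>1" "dim M\<^sub>1 \<le> CARD('m)" "subspace M\<^sub>2" "dim M\<^sub>2 \<le> CARD('n)"
     "subspace M\<^sub>3" "dim M\<^sub>3 \<le> CARD('m)" "r > 0" for M\<^sub>1 M\<^sub>2 M\<^sub>3 and c :: "real^'n^'m" and r
  proof -
    define P1 where "P1 \<Theta> \<longleftrightarrow> (\<forall>(x, y)\<in>M\<^sub>1. norm (y - \<Theta> *v x) \<ge> \<kappa> * norm (r *\<^sub>R x, y - c *v x))" for \<Theta>
    define P2 where "P2 \<Theta> \<longleftrightarrow> (\<forall>(x, y)\<in>M\<^sub>2.
      norm (y - transpose \<Theta> *v x) \<ge> \<kappa> * norm (r *\<^sub>R x, y - transpose c *v x))" for \<Theta>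
    define P3 where "P3 \<Theta> \<longleftrightarrow> (\<forall>(x, y)\<in>M\<^sub>3. y = \<Theta> *v x \<longrightarrow> x = 0 \<and> y = 0)" for \<Theta>
    have P1: "P1 \<Theta>" if "\<forall>(x, y)\<in>M\<^sub>1. norm (y - \<Theta> *v x) \<ge> \<kappa>\<^sub>1 * norm (r *\<^sub>R x, y - c *v x)" for \<Theta>
    proof -
      have "\<kappa> * norm (r *\<^sub>R x, y - c *v x) \<le> \<kappa>\<^sub>1 * norm (r *\<^sub>R x, y - c *v x)" for x y
        by (intro mult_right_mono) (auto simp: \<kappa>_def)
      then show ?thesis using that unfolding P1_def by (fastforce intro: order_trans)
    qed
    have P2: "P2 \<Theta>" if c': "cball c' r' \<subseteq> cball c r" "r' = q ^ N\<^sub>1 * r" and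
      A: "\<forall>(x, y)\<in>M\<^sub>2. norm (y - transpose \<Theta> *v x) \<ge> \<kappa>\<^sub>2 * norm (r' *\<^sub>R x, y - transpose c' *v x)" for \<Theta> c' r'
    proof -
      have "r' > 0" using c' qN M(7) by simp
      then have "c' \<in> cball c r" using c'(1) by force
      then have dist: "dist (transpose c) (transpose c') \<le> r" by (simp add: dist_transpose)
      have "\<kappa> * norm (r *\<^sub>R x, y - transpose c *v x) \<le> \<kappa>\<^sub>2 * norm (r' *\<^sub>R x, y - transpose c' *v x)" for x y
      proof -
        have "\<kappa> * norm (r *\<^sub>R x, y - transpose c *v x) \<le> (\<kappa>\<^sub>2 * q ^ N\<^sub>1 / 3) * (3 / q ^ N\<^sub>1 * norm ((q ^ N\<^sub>1 * r) *\<^sub>R x, y - transpose c' *v x))"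
          using \<kappa> N2(1) qN norm_recenter[OF dist qN] by (intro mult_mono) (auto simp: \<kappa>_def)
        also have "\<dots> = \<kappa>\<^sub>2 * norm (r' *\<^sub>R x, y - transpose c' *v x)" using c'(2) alpha beta by simp
        finally show ?thesis .
      qed
      then show ?thesis using A unfolding P2_def by (fastforce intro: order_trans)
    qed
    have P3: "P3 \<Theta>" if "r' > 0" and A: "\<forall>(x, y)\<in>M\<^sub>3. norm (y - \<Theta> *v x) \<ge> \<kappa>\<^sub>1 * norm (r' *\<^sub>R x, y - c' *v x)" for \<Theta> c' r'
      unfolding P3_def
    proof (intro ballI, clarify)
      fix x assume "(x, \<Theta> *v x) \<in> M\<^sub>3"
      then have "\<kappa>\<^sub>1 * norm (r' *\<^sub>R x, \<Theta> *v x - c' *v x) \<le> 0" using A by fastforce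
      then have "norm (r' *\<^sub>R x, \<Theta> *v x - c' *v x) \<le> 0" using N1(1) by (simp add: mult_le_0_iff)
      then have "x = 0" using that(1) by (simp add: zero_prod_def)
      then show "x = 0 \<and> \<Theta> *v x = 0" by simp
    qed
    have "forces \<alpha> \<beta> N\<^sub>1 (\<lambda>c' r'. r' = q ^ N\<^sub>1 * r \<and> cball c' r' \<subseteq> cball c r \<and> (\<forall>\<Theta>\<in>cball c' r'. P1 \<Theta>)) c r"
      using forces_nested[OF M(7) N1(2)[OF M(1,2,7)]] by (rule forces_mono) (use P1 in blast)
    then have "forces \<alpha> \<beta> (N\<^sub>1 + N\<^sub>2) (\<lambda>c' r'. r' > 0 \<and> (\<forall>\<Theta>\<in>cball c' r'. P1 \<Theta> \<and> P2 \<Theta>)) c r"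
    proof (rule forces_compose)
      fix c' r'
      assume A: "r' = q ^ N\<^sub>1 * r \<and> cball c' r' \<subseteq> cball c r \<and> (\<forall>\<Theta>\<in>cball c' r'. P1 \<Theta>)"
      then have r': "r' > 0" using qN M(7) by simp
      show "forces \<alpha> \<beta> N\<^sub>2 (\<lambda>c' r'. r' > 0 \<and> (\<forall>\<Theta>\<in>cball c' r'. P1 \<Theta> \<and> P2 \<Theta>)) c' r'"
        using forces_nested[OF r' N2(2)[OF M(3,4) r']]
      proof (rule forces_mono)
        fix c'' r''
        assume B: "(\<forall>\<Theta>\<in>cball c'' r''. \<forall>(x, y)\<in>M\<^sub>2.
          norm (y - transpose \<Theta> *v x) \<ge> \<kappa>\<^sub>2 * norm (r' *\<^sub>R x, y - transpose c' *v x)) \<and>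
          r'' = q ^ N\<^sub>2 * r' \<and> cball c'' r'' \<subseteq> cball c' r'"
        then have "r'' > 0" using r' q_pos by simp
        moreover have "P1 \<Theta> \<and> P2 \<Theta>" if \<Theta>: "\<Theta> \<in> cball c'' r''" for \<Theta>
          using A B \<Theta> P2[of c' r' \<Theta>] by blast
        ultimately show "r'' > 0 \<and> (\<forall>\<Theta>\<in>cball c'' r''. P1 \<Theta> \<and> P2 \<Theta>)" by blast
      qed
    qed
    then have "forces \<alpha> \<beta> (N\<^sub>1 + N\<^sub>2 + N\<^sub>1) (\<lambda>c' r'. \<forall>\<Theta>\<in>cball c' r'. P1 \<Theta> \<and> P2 \<Theta> \<and> P3 \<Theta>) c r"
    proof (rule forces_compose)
      fix c' r'
      assume A: "r' > 0 \<and> (\<forall>\<Theta>\<in>cball c' r'. P1 \<Theta> \<and> P2 \<Theta>)"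
      then have r': "r' > 0" by simp
      from forces_nested[OF r' N1(2)[OF M(5,6) r']]
      show "forces \<alpha> \<beta> N\<^sub>1 (\<lambda>c' r'. \<forall>\<Theta>\<in>cball c' r'. P1 \<Theta> \<and> P2 \<Theta> \<and> P3 \<Theta>) c' r'"
        by (rule forces_mono) (use A P3[OF r'] in blast)
    qed
    then show ?thesis unfolding P1_def P2_def P3_def .
  qed
  then show ?thesis using \<kappa> by blast
qed

end

subsection \<open>The winning strategy\<close>

context schmidt_game
begin

lemma winning_N_irr: "winning \<alpha> \<beta> (N_irr :: (real^'n^'m) set)"
proof -
  define d where "d = CARD('n) + CARD('m)"
  have d: "d > 0" by (simp add: d_def)
  obtain N \<kappa> where \<kappa>: "\<kappa> > 0" and N: "\<And>M\<^sub>1 M\<^sub>2 M\<^sub>3 c r. subspace M\<^sub>1 \<Longrightarrow> dim M\<^sub>1 \<le> CARD('m) \<Longrightarrow>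
     subspace M\<^sub>2 \<Longrightarrow> dim M\<^sub>2 \<le> CARD('n) \<Longrightarrow> subspace M\<^sub>3 \<Longrightarrow> dim M\<^sub>3 \<le> CARD('m) \<Longrightarrow> r > 0 \<Longrightarrow>
     forces \<alpha> \<beta> N (\<lambda>c' r'. \<forall>\<Theta>\<in>cball c' r'.
       (\<forall>(x, y)\<in>M\<^sub>1. norm (y - \<Theta> *v x) \<ge> \<kappa> * norm (r *\<^sub>R x, y - c *v x)) \<and>
       (\<forall>(x, y)\<in>M\<^sub>2. norm (y - transpose \<Theta> *v x) \<ge> \<kappa> * norm (r *\<^sub>R x, y - transpose c *v x)) \<and>
       (\<forall>(x, y)\<in>M\<^sub>3. y = \<Theta> *v x \<longrightarrow> x = 0 \<and> y = 0)) (c :: real^'n^'m) r"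
    using forces_transversal_triple by blast
  obtain t where t: "q ^ t < \<kappa>" using real_arch_pow_inv[OF \<kappa> q_less_1] by blast
  \<comment> \<open>With p = q^s and T = d s, a stage multiplies the radius by p^d and the scale
    \<theta> by p. Here \<open>s\<close> exceeds \<open>t\<close>, to get p \<le> \<kappa>, and
    \<open>N\<close>, so that the forcing fits into a stage; the successor gives p < 1.\<close>
  define s where "s = Suc (max N t)"
  define p where "p = q ^ s"
  have "p \<le> q ^ t" unfolding p_def using q_pos q_less_1 by (intro power_decreasing) (auto simp: s_def)
  moreover have "p < 1" unfolding p_def using q_pos q_less_1 by (simp add: power_less_one_iff s_def del: power_Suc)
  ultimately have p: "0 < p" "p < 1" "p \<le> \<kappa>" using q_pos t by (auto simp: p_def)
  define T where "T = d * s"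
  have "1 * s \<le> d * s" using d by (intro mult_right_mono) auto
  moreover have "0 < s" "N \<le> s" by (auto simp: s_def)
  ultimately have T: "T > 0" "N \<le> T" unfolding T_def by linarith+
  have qT: "q ^ T = p ^ d" by (simp add: T_def p_def mult.commute flip: power_mult)
  \<comment> \<open>The slack of \<open>well_spaced_step\<close>, which is known before \<delta> is
    chosen.\<close>
  have K: "3 / p ^ d > 0" using p by simp
  obtain \<delta>\<^sub>1 where \<delta>1: "\<delta>\<^sub>1 > 0" "\<And>\<delta> \<theta> \<Theta>. 0 < \<delta> \<Longrightarrow> \<delta> \<le> \<delta>\<^sub>1 \<Longrightarrow> \<theta> > 0 \<Longrightarrow>
    well_spaced (transpose \<Theta>) \<theta> \<delta> \<Longrightarrow>
    dim {X. integer_vector X \<and> norm (scaled_forms (\<Theta> :: real^'n^'m) \<theta> X) \<le> 3 / p ^ d * \<delta> ^ CARD('n)} \<le> CARD('m)"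
    using dim_short_vectors_le[OF K] by blast
  obtain \<delta>\<^sub>2 where \<delta>2: "\<delta>\<^sub>2 > 0" "\<And>\<delta> \<theta> \<Theta>. 0 < \<delta> \<Longrightarrow> \<delta> \<le> \<delta>\<^sub>2 \<Longrightarrow> \<theta> > 0 \<Longrightarrow>
    well_spaced (transpose \<Theta>) \<theta> \<delta> \<Longrightarrow>
    dim {X. integer_vector X \<and> norm (scaled_forms (\<Theta> :: real^'m^'n) \<theta> X) \<le> 3 / p ^ d * \<delta> ^ CARD('m)} \<le> CARD('n)"
    using dim_short_vectors_le[OF K] by blast
  define Ms where "Ms = from_nat_into {M :: ((real^'n) \<times> (real^'m)) set. rational_subspace M \<and> dim M \<le> CARD('m)}"
  have "countable {M :: ((real^'n) \<times> (real^'m)) set. rational_subspace M \<and> dim M \<le> CARD('m)}"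
    by (rule countable_subset[OF _ countable_rational_subspaces]) auto
  \<comment> \<open>The zero subspace shows that the set is nonempty, so that
    \<open>from_nat_into\<close> enumerates exactly its elements.\<close>
  moreover have "span {} \<in> {M :: ((real^'n) \<times> (real^'m)) set. rational_subspace M \<and> dim M \<le> CARD('m)}"
    unfolding rational_subspace_def by (auto intro!: exI[of _ "{}"] independent_empty)
  ultimately have ran: "range Ms = {M. rational_subspace M \<and> dim M \<le> CARD('m)}"
    unfolding Ms_def by (intro range_from_nat_into) auto
  have Ms: "subspace (Ms k)" "dim (Ms k) \<le> CARD('m)" for k
  proof -
    have "Ms k \<in> {M. rational_subspace M \<and> dim M \<le> CARD('m)}" unfolding ran[symmetric] by simp
    then show "subspace (Ms k)" "dim (Ms k) \<le> CARD('m)"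
      using rational_subspace_imp_subspace by blast+
  qed
  \<comment> \<open>The scale of a ball is the d-th root of its radius, in accordance with
    \<open>scaled_forms\<close>.\<close>
  define \<theta>\<^sub>0 where "\<theta>\<^sub>0 D = root d (snd D)" for D :: "(real^'n^'m) gball"
  have \<theta>0: "\<theta>\<^sub>0 D > 0" "\<theta>\<^sub>0 D ^ d = snd D" if "snd D > 0" for D
    using that d by (simp_all add: \<theta>\<^sub>0_def)
  have "\<exists>\<delta>. 0 < \<delta> \<and> \<delta> \<le> \<delta>\<^sub>1 \<and> \<delta> \<le> \<delta>\<^sub>2 \<and> well_spaced (fst D) (\<theta>\<^sub>0 D) \<delta> \<and>
      well_spaced (transpose (fst D)) (\<theta>\<^sub>0 D) \<delta>" if D: "snd D > 0" for D
  proof -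
    obtain e\<^sub>1 where e1: "e\<^sub>1 > 0" "\<And>\<delta>. 0 < \<delta> \<Longrightarrow> \<delta> \<le> e\<^sub>1 \<Longrightarrow> well_spaced (fst D) (\<theta>\<^sub>0 D) \<delta>"
      using well_spaced_exists[OF \<theta>0(1)[OF D]] by blast
    obtain e\<^sub>2 where e2: "e\<^sub>2 > 0" "\<And>\<delta>. 0 < \<delta> \<Longrightarrow> \<delta> \<le> e\<^sub>2 \<Longrightarrow> well_spaced (transpose (fst D)) (\<theta>\<^sub>0 D) \<delta>"
      using well_spaced_exists[OF \<theta>0(1)[OF D]] by blast
    show ?thesis
      using e1 e2 \<delta>1(1) \<delta>2(1) by (intro exI[of _ "min (min e\<^sub>1 e\<^sub>2) (min \<delta>\<^sub>1 \<delta>\<^sub>2)"]) auto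
  qed
  then obtain \<delta> where \<delta>: "\<And>D. snd D > 0 \<Longrightarrow> 0 < \<delta> D \<and> \<delta> D \<le> \<delta>\<^sub>1 \<and> \<delta> D \<le> \<delta>\<^sub>2 \<and>
      well_spaced (fst D) (\<theta>\<^sub>0 D) (\<delta> D) \<and> well_spaced (transpose (fst D)) (\<theta>\<^sub>0 D) (\<delta> D)"
    by metis
  \<comment> \<open>The threshold \<open>\<delta> D\<close> depends on Bob's first ball
    \<open>D\<close> alone. The index is shifted because the k-th subspace is treated during stage
    \<open>k\<close>, that is, before the state numbered \<open>Suc k\<close>.\<close>
  define Inv where "Inv D k c r \<longleftrightarrow> r = (p ^ k * \<theta>\<^sub>0 D) ^ d \<and>
    well_spaced c (p ^ k * \<theta>\<^sub>0 D) (\<delta> D) \<and> well_spaced (transpose c) (p ^ k * \<theta>\<^sub>0 D) (\<delta> D) \<and>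
    (k > 0 \<longrightarrow> (\<forall>\<Theta>\<in>cball c r. \<forall>(x, y)\<in>Ms (k - 1). y = \<Theta> *v x \<longrightarrow> x = 0 \<and> y = 0))" for D k c r
  show ?thesis
  proof (rule winning_if_stages[OF T(1), of Inv])
    fix c :: "real^'n^'m" and r :: real assume "r > 0"
    then show "Inv (c, r) 0 c r" using \<delta>[of "(c, r)"] \<theta>0(2)[of "(c, r)"] by (simp add: Inv_def)
  next
    fix D :: "(real^'n^'m) gball" and k c r
    assume D: "snd D > 0" and r: "r > 0" and I: "Inv D k c r"
    define \<theta> where "\<theta> = p ^ k * \<theta>\<^sub>0 D"
    have \<theta>: "\<theta> > 0" using p \<theta>0(1)[OF D] by (simp add: \<theta>_def)
    have I': "r = \<theta> ^ d" "well_spaced c \<theta> (\<delta> D)" "well_spaced (transpose c) \<theta> (\<delta> D)"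
      using I by (auto simp: Inv_def \<theta>_def)
    define M\<^sub>1 where "M\<^sub>1 = span {X. integer_vector X \<and> norm (scaled_forms c \<theta> X) \<le> 3 / p ^ d * \<delta> D ^ CARD('n)}"
    define M\<^sub>2 where "M\<^sub>2 = span {X. integer_vector X \<and>
      norm (scaled_forms (transpose c) \<theta> X) \<le> 3 / p ^ d * \<delta> D ^ CARD('m)}"
    have M1: "subspace M\<^sub>1" "dim M\<^sub>1 \<le> CARD('m)"
      using \<delta>1(2)[of "\<delta> D" \<theta> c] \<delta>[OF D] \<theta> I' by (auto simp: M\<^sub>1_def)
    have M2: "subspace M\<^sub>2" "dim M\<^sub>2 \<le> CARD('n)"
      using \<delta>2(2)[of "\<delta> D" \<theta> "transpose c"] \<delta>[OF D] \<theta> I' by (auto simp: M\<^sub>2_def)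
    have "forces \<alpha> \<beta> T (\<lambda>c' r'. \<forall>\<Theta>\<in>cball c' r'.
       (\<forall>(x, y)\<in>M\<^sub>1. norm (y - \<Theta> *v x) \<ge> \<kappa> * norm (r *\<^sub>R x, y - c *v x)) \<and>
       (\<forall>(x, y)\<in>M\<^sub>2. norm (y - transpose \<Theta> *v x) \<ge> \<kappa> * norm (r *\<^sub>R x, y - transpose c *v x)) \<and>
       (\<forall>(x, y)\<in>Ms k. y = \<Theta> *v x \<longrightarrow> x = 0 \<and> y = 0)) c r"
      by (rule forces_longer[OF r N[OF M1 M2 Ms r] T(2)]) blast
    from forces_nested[OF r this] show "forces \<alpha> \<beta> T (Inv D (Suc k)) c r"
    proof (rule forces_mono)
      fix c' r'
      assume A: "(\<forall>\<Theta>\<in>cball c' r'.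
       (\<forall>(x, y)\<in>M\<^sub>1. norm (y - \<Theta> *v x) \<ge> \<kappa> * norm (r *\<^sub>R x, y - c *v x)) \<and>
       (\<forall>(x, y)\<in>M\<^sub>2. norm (y - transpose \<Theta> *v x) \<ge> \<kappa> * norm (r *\<^sub>R x, y - transpose c *v x)) \<and>
       (\<forall>(x, y)\<in>Ms k. y = \<Theta> *v x \<longrightarrow> x = 0 \<and> y = 0)) \<and> r' = q ^ T * r \<and> cball c' r' \<subseteq> cball c r"
      have "r' > 0" using A r q_pos by simp
      then have c': "c' \<in> cball c' r'" by simp
      then have "c' \<in> cball c r" using A by blast
      then have dist: "dist c c' \<le> \<theta> ^ d" using I'(1) by simp
      have tr1: "norm (y - c' *v x) \<ge> \<kappa> * norm (\<theta> ^ d *\<^sub>R x, y - c *v x)" if "(x, y) \<in> M\<^sub>1" for x y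
        using A c' that I'(1) by blast
      have tr2: "norm (y - transpose c' *v x) \<ge> \<kappa> * norm (\<theta> ^ d *\<^sub>R x, y - transpose c *v x)"
        if "(x, y) \<in> M\<^sub>2" for x y
        using A c' that I'(1) by blast
      have ws: "well_spaced c' (p * \<theta>) (\<delta> D)"
        using \<theta> p \<delta>[OF D] I' dist tr1 unfolding M\<^sub>1_def d_def by (intro well_spaced_step[of \<theta> p \<kappa> "\<delta> D" c]) auto
      have ws': "well_spaced (transpose c') (p * \<theta>) (\<delta> D)"
        using \<theta> p \<delta>[OF D] I' dist tr2 unfolding M\<^sub>2_def d_def
        by (intro well_spaced_step[of \<theta> p \<kappa> "\<delta> D" "transpose c"]) (auto simp: dist_transpose add.commute)
      have "r' = (p * \<theta>) ^ d" using A I'(1) qT by (simp add: power_mult_distrib)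
      moreover have "\<forall>\<Theta>\<in>cball c' r'. \<forall>(x, y)\<in>Ms k. y = \<Theta> *v x \<longrightarrow> x = 0 \<and> y = 0" using A by blast
      ultimately show "Inv D (Suc k) c' r'" using ws ws'
        unfolding Inv_def \<theta>_def mult.assoc[symmetric] power_Suc[symmetric] by simp
    qed
  next
    fix B :: "nat \<Rightarrow> (real^'n^'m) gball" and \<Theta>
    assume B0: "snd (B 0) > 0" and I: "\<And>k. Inv (B 0) k (fst (B (k * T))) (snd (B (k * T)))"
      and \<Theta>: "\<And>i. \<Theta> \<in> ball_set (B i)"
    have "badly_approximable \<Theta>"
    proof (rule badly_approximable_if_well_spaced[OF p(1,2) \<theta>0(1)[OF B0]])
      show "0 < \<delta> (B 0)" using \<delta>[OF B0] by blast
      fix k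
      have "dist (fst (B (k * T))) \<Theta> \<le> (p ^ k * \<theta>\<^sub>0 (B 0)) ^ d"
        using \<Theta>[of "k * T"] I[of k] by (simp add: ball_set_def Inv_def)
      then show "\<exists>c. dist c \<Theta> \<le> (p ^ k * \<theta>\<^sub>0 (B 0)) ^ (CARD('n) + CARD('m)) \<and>
          well_spaced c (p ^ k * \<theta>\<^sub>0 (B 0)) (\<delta> (B 0))"
        using I[of k] unfolding Inv_def d_def by blast
    qed
    moreover have "completely_irrational {(x, y). y = \<Theta> *v x}"
    proof (rule completely_irrational_graph)
      fix M x y
      assume M: "rational_subspace M" "dim M \<le> CARD('m)" and xy: "(x, y) \<in> M" "y = \<Theta> *v x"
      then have "M \<in> range Ms" unfolding ran by simp
      then obtain k where k: "M = Ms k" by blast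
      \<comment> \<open>Stage \<open>k\<close> has disposed of \<open>Ms k\<close>, and the limit
        point still lies in the ball at its end.\<close>
      have "\<Theta> \<in> cball (fst (B (Suc k * T))) (snd (B (Suc k * T)))"
        using \<Theta>[of "Suc k * T"] by (simp add: ball_set_def)
      then have "\<forall>(x, y)\<in>Ms k. y = \<Theta> *v x \<longrightarrow> x = 0 \<and> y = 0"
        using I[of "Suc k"] unfolding Inv_def diff_Suc_1 by blast
      then show "x = 0 \<and> y = 0" using xy k by blast
    qed
    ultimately show "\<Theta> \<in> N_irr" by (simp add: N_irr_def)
  qed
qed

end

theorem theorem2p2:
  fixes \<alpha> :: real
  assumes "0 < \<alpha>" and "\<alpha> \<le> 1 / 2"
  shows "alpha_winning \<alpha> (N_irr :: (real^'n^'m) set)"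
  unfolding alpha_winning_def
proof (intro allI impI)
  fix \<beta> :: real assume "0 < \<beta> \<and> \<beta> < 1"
  then interpret schmidt_game \<alpha> \<beta> using assms by unfold_locales auto
  show "winning \<alpha> \<beta> (N_irr :: (real^'n^'m) set)" by (rule winning_N_irr)
qed

end
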